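(* Let $X$ be a nonempty open bounded subset of $\mathbb{R}^n$. The set $C_{ae}(X,\mathbb{R})$ endowed with the metric $r$ is a complete metric space, and the subset $C^0(X,\mathbb{R})$ of (classes of) bounded continuous functions is dense in $C_{ae}(X,\mathbb{R})$.
   Context: $C_{ae}(X,\mathbb{R})$ is the set of equivalence classes of bounded functions $X\to\mathbb{R}$ that are continuous at almost every point, two functions being equivalent if they coincide almost everywhere; $f\le g$ means $\varphi\le\psi$ a.e. for representatives. For $k\in\mathbb{N}$, $f_k^-=\sup\{\varphi\in Lip_k(X,\mathbb{R}):\varphi\le f\}$ and $f_k^+=\inf\{\varphi\in Lip_k(X,\mathbb{R}):\varphi\ge f\}$, $Lip_k$ being the $k$-Lipschitz functions. For bounded continuous $\varphi,\psi$ let $h(\varphi,\psi)$ be the Hausdorff distance between closures of their graphs in $\mathrm{cl}X\times\mathbb{R}$ and $\delta(\varphi,\psi)=h(\varphi,\psi)+\int_X|\varphi(x)-\psi(x)|\,dx$. Then $r(f,g)=\sup_{k\in\mathbb{N}}\max\{\delta(f_k^-,g_k^-),\delta(f_k^+,g_k^+)\}$. *)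

theory Defs
  imports "HOL-Analysis.Analysis"
begin

definition hausdorff_dist :: "'a::metric_space set \<Rightarrow> 'a set \<Rightarrow> real" where
  "hausdorff_dist A B = max (SUP a\<in>A. infdist a B) (SUP b\<in>B. infdist b A)"

text \<open>Representatives of elements of C_ae(X,R): functions bounded on X and continuous
  at almost every point of X.\<close>
definition Cae :: "'a::euclidean_space set \<Rightarrow> ('a \<Rightarrow> real) set" where
  "Cae X = {f. bounded (f ` X) \<and> (AE x in lebesgue. x \<in> X \<longrightarrow> continuous (at x within X) f)}"

text \<open>Equality almost everywhere on X (equality in C_ae).\<close>
definition ae_eq :: "'a::euclidean_space set \<Rightarrow> ('a \<Rightarrow> real) \<Rightarrow> ('a \<Rightarrow> real) \<Rightarrow> bool" where
  "ae_eq X f g \<longleftrightarrow> (AE x in lebesgue. x \<in> X \<longrightarrow> f x = g x)"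

definition ae_le :: "'a::euclidean_space set \<Rightarrow> ('a \<Rightarrow> real) \<Rightarrow> ('a \<Rightarrow> real) \<Rightarrow> bool" where
  "ae_le X f g \<longleftrightarrow> (AE x in lebesgue. x \<in> X \<longrightarrow> f x \<le> g x)"

definition lower_env :: "'a::euclidean_space set \<Rightarrow> nat \<Rightarrow> ('a \<Rightarrow> real) \<Rightarrow> 'a \<Rightarrow> real" where
  "lower_env X k f = (\<lambda>x. Sup {\<phi> x | \<phi>. (real k)-lipschitz_on X \<phi> \<and> ae_le X \<phi> f})"

definition upper_env :: "'a::euclidean_space set \<Rightarrow> nat \<Rightarrow> ('a \<Rightarrow> real) \<Rightarrow> 'a \<Rightarrow> real" where
  "upper_env X k f = (\<lambda>x. Inf {\<phi> x | \<phi>. (real k)-lipschitz_on X \<phi> \<and> ae_le X f \<phi>})"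

definition graph_on :: "'a set \<Rightarrow> ('a \<Rightarrow> real) \<Rightarrow> ('a \<times> real) set" where
  "graph_on X \<phi> = {(x, \<phi> x) | x. x \<in> X}"

definition hgraph :: "'a::euclidean_space set \<Rightarrow> ('a \<Rightarrow> real) \<Rightarrow> ('a \<Rightarrow> real) \<Rightarrow> real" where
  "hgraph X \<phi> \<psi> = hausdorff_dist (closure (graph_on X \<phi>)) (closure (graph_on X \<psi>))"

definition delta :: "'a::euclidean_space set \<Rightarrow> ('a \<Rightarrow> real) \<Rightarrow> ('a \<Rightarrow> real) \<Rightarrow> real" where
  "delta X \<phi> \<psi> = hgraph X \<phi> \<psi> + integral X (\<lambda>x. \<bar>\<phi> x - \<psi> x\<bar>)"

text \<open>The metric r (valued in the extended reals; finiteness is part of the claim).\<close>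
definition r_metric :: "'a::euclidean_space set \<Rightarrow> ('a \<Rightarrow> real) \<Rightarrow> ('a \<Rightarrow> real) \<Rightarrow> ereal" where
  "r_metric X f g = (SUP k\<in>{1::nat..}. ereal (max (delta X (lower_env X k f) (lower_env X k g))
                                                  (delta X (upper_env X k f) (upper_env X k g))))"

end

theory Submission
  imports Defs
begin

text \<open>On \<open>X\<close> the envelopes of \<open>f\<close> are inf- and sup-convolutions of \<open>f\<close> over its dense set of
  continuity points, and they converge to \<open>f\<close> there. For a Cauchy sequence the \<open>k\<close>-th envelopes
  converge uniformly to some \<open>u k\<close> and \<open>v k\<close>; since the convergence in \<open>\<delta>\<close> is uniform in \<open>k\<close>, the
  integrals of \<open>v k - u k\<close> tend to 0, so that \<open>f = sup u k\<close> is continuous almost everywhere, and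
  its envelopes are again \<open>u k\<close> and \<open>v k\<close>.

  For density, the envelopes \<open>lower_env X m f\<close> need not approximate \<open>f\<close>, because \<open>X\<close> may be
  wildly disconnected near its boundary. Instead \<open>f\<close> is approximated by
  \<open>g x = inf (f c + w x * dist x c)\<close> with a continuous slope \<open>w\<close> growing fast enough towards the
  boundary. Near a fixed point a large slope \<open>k\<close> is compared inside a ball contained in \<open>X\<close>, by
  the intermediate value theorem; for the remaining \<open>k\<close> the slope \<open>w\<close> exceeds \<open>k\<close> wherever it
  matters, and the \<open>k\<close>-th envelopes of \<open>f\<close> and \<open>g\<close> nearly agree.\<close>

section \<open>Hausdorff distance of graphs and the distance delta\<close>

text \<open>The supremum over \<open>k\<close> shapes both halves. Two \<open>k\<close>-Lipschitz
  functions whose graphs are within \<open>e\<close> are only known to differ by less than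
  \<open>(1 + k) * e\<close>, so uniform limits are available for one slope at a time; an estimate
  for all slopes at once can only compare a value at \<open>x\<close> with a value at some nearby
  point. Where values at the same point matter, the integral term of \<open>delta\<close> supplies
  them: it is what closes the gap between \<open>u k\<close> and \<open>v k\<close>.

  The density proof splits accordingly at a threshold slope \<open>L x\<close> that depends on the
  point. Above the threshold, the envelopes of \<open>f\<close> and \<open>g\<close> at
  \<open>x\<close> itself are only known to lie in the gap between the two envelopes of
  \<open>f\<close> at one fixed slope \<open>j\<close>; this gap need not be small at
  \<open>x\<close>, but its integral is.\<close>

lemma bdd_above_infdist:
  fixes A B :: "'a::metric_space set"
  assumes "bounded A" "B \<noteq> {}"
  shows "bdd_above ((\<lambda>a. infdist a B) ` A)"
proof -
  obtain b where b: "b \<in> B" using assms by auto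
  obtain e where e: "\<And>a. a \<in> A \<Longrightarrow> dist b a \<le> e"
    using assms(1) bounded_any_center[of A b] by auto
  have "infdist a B \<le> e" if "a \<in> A" for a
    using infdist_le[OF b, of a] e[OF that] by (simp add: dist_commute)
  then show ?thesis by (rule bdd_aboveI2)
qed

lemma infdist_le_hausdorff_dist:
  fixes A B :: "'a::metric_space set"
  assumes "bounded A" "B \<noteq> {}" "a \<in> A"
  shows "infdist a B \<le> hausdorff_dist A B"
  using cSUP_upper[OF assms(3) bdd_above_infdist[OF assms(1,2)]]
  unfolding hausdorff_dist_def by linarith

lemma hausdorff_dist_commute: "hausdorff_dist A B = hausdorff_dist B A"
  unfolding hausdorff_dist_def by (simp add: max.commute)

lemma hausdorff_dist_leI:
  fixes A B :: "'a::metric_space set"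
  assumes "A \<noteq> {}" "B \<noteq> {}"
    and "\<And>a. a \<in> A \<Longrightarrow> infdist a B \<le> e" "\<And>b. b \<in> B \<Longrightarrow> infdist b A \<le> e"
  shows "hausdorff_dist A B \<le> e"
  unfolding hausdorff_dist_def by (intro max.boundedI cSUP_least assms)

lemma hausdorff_dist_nonneg:
  fixes A B :: "'a::metric_space set"
  assumes "bounded A" "A \<noteq> {}" "B \<noteq> {}"
  shows "0 \<le> hausdorff_dist A B"
proof -
  obtain a where "a \<in> A" using assms by auto
  then show ?thesis
    using infdist_le_hausdorff_dist[OF assms(1,3)] infdist_nonneg order_trans by blast
qed

lemma hausdorff_dist_triangle:
  fixes A B C :: "'a::metric_space set"
  assumes bd: "bounded A" "bounded B" "bounded C" and ne: "A \<noteq> {}" "B \<noteq> {}" "C \<noteq> {}"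
  shows "hausdorff_dist A C \<le> hausdorff_dist A B + hausdorff_dist B C"
proof -
  have *: "infdist a C' \<le> hausdorff_dist A' B + hausdorff_dist B C'"
    if "bounded A'" "a \<in> A'" "C' \<noteq> {}" for a A' C'
  proof -
    have "infdist a C' - hausdorff_dist B C' \<le> dist a b" if "b \<in> B" for b
      using infdist_triangle[of a C' b] infdist_le_hausdorff_dist[OF bd(2) \<open>C' \<noteq> {}\<close> that]
      by linarith
    then have "infdist a C' - hausdorff_dist B C' \<le> infdist a B"
      unfolding infdist_notempty[OF ne(2)] by (intro cINF_greatest[OF ne(2)])
    also have "\<dots> \<le> hausdorff_dist A' B"
      using infdist_le_hausdorff_dist[OF that(1) ne(2) that(2)] .
    finally show ?thesis by simp
  qed
  show ?thesis
  proof (rule hausdorff_dist_leI[OF ne(1,3)])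
    show "infdist a C \<le> hausdorff_dist A B + hausdorff_dist B C" if "a \<in> A" for a
      using *[OF bd(1) that ne(3)] .
    show "infdist c A \<le> hausdorff_dist A B + hausdorff_dist B C" if "c \<in> C" for c
      using *[OF bd(3) that ne(1)] hausdorff_dist_commute by (metis add.commute)
  qed
qed

lemma hausdorff_dist_self:
  fixes A :: "'a::metric_space set"
  assumes "A \<noteq> {}"
  shows "hausdorff_dist A A = 0"
  unfolding hausdorff_dist_def using assms by simp

section \<open>Graph distance\<close>

lemma dist_Pair_le: "dist (x, a) (y, b) \<le> dist x y + dist a b"
  unfolding dist_Pair_Pair by (rule sqrt_sum_squares_le_sum) auto

lemma bounded_graph_on:
  fixes X :: "'a::euclidean_space set"
  assumes "bounded X" "bounded (\<phi> ` X)"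
  shows "bounded (closure (graph_on X \<phi>))"
proof -
  have "graph_on X \<phi> \<subseteq> X \<times> \<phi> ` X" unfolding graph_on_def by auto
  then show ?thesis
    using bounded_Times[OF assms] bounded_subset bounded_closure by blast
qed

lemma closure_graph_on_nonempty: "X \<noteq> {} \<Longrightarrow> closure (graph_on X \<phi>) \<noteq> {}"
  unfolding graph_on_def by auto

text \<open>Graph points suffice, because a bound on \<open>infdist\<close> is a closed condition
  and passes to the closure. The horizontal and vertical tolerances are separate since they differ
  in the applications.\<close>

lemma hgraph_leI:
  fixes X :: "'a::euclidean_space set"
  assumes ne: "X \<noteq> {}"
    and 1: "\<And>x. x \<in> X \<Longrightarrow> \<exists>y\<in>X. dist x y \<le> e \<and> \<bar>\<phi> x - \<psi> y\<bar> \<le> e'"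
    and 2: "\<And>x. x \<in> X \<Longrightarrow> \<exists>y\<in>X. dist x y \<le> e \<and> \<bar>\<psi> x - \<phi> y\<bar> \<le> e'"
  shows "hgraph X \<phi> \<psi> \<le> e + e'"
proof -
  have *: "infdist p (closure (graph_on X \<psi>')) \<le> e + e'"
    if p: "p \<in> closure (graph_on X \<phi>')"
      and H: "\<And>x. x \<in> X \<Longrightarrow> \<exists>y\<in>X. dist x y \<le> e \<and> \<bar>\<phi>' x - \<psi>' y\<bar> \<le> e'" for p \<phi>' \<psi>'
  proof -
    let ?S = "{p. infdist p (closure (graph_on X \<psi>')) \<le> e + e'}"
    have "closed ?S"
      by (intro closed_Collect_le continuous_intros)
    moreover have "graph_on X \<phi>' \<subseteq> ?S"
    proof
      fix q assume "q \<in> graph_on X \<phi>'"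
      then obtain x where x: "x \<in> X" "q = (x, \<phi>' x)" unfolding graph_on_def by auto
      obtain y where y: "y \<in> X" "dist x y \<le> e" "\<bar>\<phi>' x - \<psi>' y\<bar> \<le> e'" using H[OF x(1)] by auto
      have "(y, \<psi>' y) \<in> closure (graph_on X \<psi>')"
        using y(1) closure_subset unfolding graph_on_def by fastforce
      from infdist_le[OF this, of q] dist_Pair_le[of x "\<phi>' x" y "\<psi>' y"] y
      show "q \<in> ?S" by (simp add: x dist_real_def)
    qed
    ultimately have "closure (graph_on X \<phi>') \<subseteq> ?S" by (rule closure_minimal[rotated])
    then show ?thesis using p by auto
  qed
  show ?thesis unfolding hgraph_def
    by (rule hausdorff_dist_leI) (use ne closure_graph_on_nonempty * 1 2 in blast)+
qed

text \<open>The strict inequality leaves room to replace a near point of the closure by a point of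
  the graph itself.\<close>

lemma hgraph_lessD:
  fixes X :: "'a::euclidean_space set"
  assumes "bounded X" "bounded (\<phi> ` X)" "x \<in> X" "hgraph X \<phi> \<psi> < e"
  shows "\<exists>y\<in>X. dist x y < e \<and> \<bar>\<phi> x - \<psi> y\<bar> < e"
proof -
  have G: "(x, \<phi> x) \<in> closure (graph_on X \<phi>)"
    using assms(3) closure_subset unfolding graph_on_def by fastforce
  have ne: "closure (graph_on X \<psi>) \<noteq> {}" using closure_graph_on_nonempty assms(3) by blast
  have "infdist (x, \<phi> x) (closure (graph_on X \<psi>)) < e"
    using infdist_le_hausdorff_dist[OF bounded_graph_on[OF assms(1,2)] ne G] assms(4)
    unfolding hgraph_def by linarith
  then have "\<exists>q\<in>closure (graph_on X \<psi>). dist (x, \<phi> x) q < e"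
    using ne by (auto simp: infdist_def cINF_less_iff)
  then obtain q where q: "q \<in> closure (graph_on X \<psi>)" "dist (x, \<phi> x) q < e" by auto
  then obtain q' where q': "q' \<in> graph_on X \<psi>" "dist q' q < e - dist (x, \<phi> x) q"
    unfolding closure_approachable by (meson diff_gt_0_iff_gt)
  obtain y where y: "y \<in> X" "q' = (y, \<psi> y)" using q'(1) unfolding graph_on_def by auto
  have "dist (x, \<phi> x) q' < e"
    using dist_triangle[of "(x, \<phi> x)" q' q] q' by (simp add: dist_commute)
  then show ?thesis
    using dist_fst_le[of "(x, \<phi> x)" q'] dist_snd_le[of "(x, \<phi> x)" q'] y
    by (auto simp: dist_real_def intro!: bexI[of _ y])
qed

lemma hgraph_commute: "hgraph X \<phi> \<psi> = hgraph X \<psi> \<phi>"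
  unfolding hgraph_def by (rule hausdorff_dist_commute)

lemma hgraph_nonneg:
  fixes X :: "'a::euclidean_space set"
  assumes "X \<noteq> {}" "bounded X" "bounded (\<phi> ` X)"
  shows "0 \<le> hgraph X \<phi> \<psi>"
  unfolding hgraph_def
  by (intro hausdorff_dist_nonneg bounded_graph_on closure_graph_on_nonempty assms)

lemma hgraph_triangle:
  fixes X :: "'a::euclidean_space set"
  assumes "X \<noteq> {}" "bounded X" "bounded (\<phi> ` X)" "bounded (\<psi> ` X)" "bounded (\<theta> ` X)"
  shows "hgraph X \<phi> \<theta> \<le> hgraph X \<phi> \<psi> + hgraph X \<psi> \<theta>"
  unfolding hgraph_def
  by (intro hausdorff_dist_triangle bounded_graph_on closure_graph_on_nonempty assms)

lemma hgraph_cong: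
  assumes "\<And>x. x \<in> X \<Longrightarrow> \<phi> x = \<phi>' x" "\<And>x. x \<in> X \<Longrightarrow> \<psi> x = \<psi>' x"
  shows "hgraph X \<phi> \<psi> = hgraph X \<phi>' \<psi>'"
proof -
  have "graph_on X \<phi> = graph_on X \<phi>'" "graph_on X \<psi> = graph_on X \<psi>'"
    using assms unfolding graph_on_def by fastforce+
  then show ?thesis unfolding hgraph_def by simp
qed

lemma lipschitz_on_bounded_image:
  fixes X :: "'a::euclidean_space set" and \<phi> :: "'a \<Rightarrow> real"
  assumes "bounded X" "L-lipschitz_on X \<phi>"
  shows "bounded (\<phi> ` X)"
  by (rule bounded_uniformly_continuous_image[OF lipschitz_on_uniformly_continuous[OF assms(2)] assms(1)])

lemma lipschitz_abs_diff_less: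
  fixes X :: "'a::euclidean_space set"
  assumes "bounded X" "L-lipschitz_on X \<phi>" "L-lipschitz_on X \<psi>" "hgraph X \<phi> \<psi> < e" "x \<in> X"
  shows "\<bar>\<phi> x - \<psi> x\<bar> < (1 + L) * e"
proof -
  obtain y where y: "y \<in> X" "dist x y < e" "\<bar>\<phi> x - \<psi> y\<bar> < e"
    using hgraph_lessD[OF assms(1) lipschitz_on_bounded_image[OF assms(1,2)] assms(5,4)] by auto
  have "\<bar>\<psi> y - \<psi> x\<bar> \<le> L * dist y x"
    using lipschitz_onD[OF assms(3) y(1) assms(5)] by (simp add: dist_real_def)
  also have "\<dots> \<le> L * e"
    using y(2) lipschitz_on_nonneg[OF assms(2)] by (simp add: dist_commute mult_left_mono)
  finally show ?thesis using y(3) by (simp add: algebra_simps)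
qed

section \<open>Integrability and the distance \<open>delta\<close>\<close>

lemma continuous_bounded_integrable_on:
  fixes X :: "'a::euclidean_space set" and \<phi> :: "'a \<Rightarrow> real"
  assumes "open X" "bounded X" "continuous_on X \<phi>" "bounded (\<phi> ` X)"
  shows "\<phi> absolutely_integrable_on X"
proof -
  obtain B where B: "\<And>x. x \<in> X \<Longrightarrow> norm (\<phi> x) \<le> B" using assms(4) by (auto simp: bounded_iff)
  have X: "X \<in> lmeasurable" using assms lmeasurable_open by blast
  show ?thesis
  proof (rule measurable_bounded_by_integrable_imp_absolutely_integrable)
    show "\<phi> \<in> borel_measurable (lebesgue_on X)"
      using continuous_imp_measurable_on_sets_lebesgue[OF assms(3)] X by (auto simp: fmeasurableD)
    show "X \<in> sets lebesgue" using X by auto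
    show "(\<lambda>_. B) integrable_on X" using X by (rule integrable_on_const)
  qed (use B in auto)
qed

lemma integrable_abs_diff:
  fixes X :: "'a::euclidean_space set" and \<phi> :: "'a \<Rightarrow> real"
  assumes "open X" "bounded X" "L-lipschitz_on X \<phi>" "L'-lipschitz_on X \<psi>"
  shows "(\<lambda>x. \<bar>\<phi> x - \<psi> x\<bar>) integrable_on X"
proof -
  have "(\<lambda>x. \<phi> x - \<psi> x) absolutely_integrable_on X"
    by (intro set_integral_diff(1) continuous_bounded_integrable_on assms(1,2)
        assms(3,4)[THEN lipschitz_on_continuous_on]
        assms(3,4)[THEN lipschitz_on_bounded_image[OF assms(2)]])
  from absolutely_integrable_norm[OF this] show ?thesis
    by (simp add: o_def set_lebesgue_integral_eq_integral(1))
qed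

lemma delta_commute: "delta X \<phi> \<psi> = delta X \<psi> \<phi>"
  unfolding delta_def by (simp add: hgraph_commute abs_minus_commute)

lemma delta_cong:
  assumes "\<And>x. x \<in> X \<Longrightarrow> \<phi> x = \<phi>' x" "\<And>x. x \<in> X \<Longrightarrow> \<psi> x = \<psi>' x"
  shows "delta X \<phi> \<psi> = delta X \<phi>' \<psi>'"
proof -
  have "integral X (\<lambda>x. \<bar>\<phi> x - \<psi> x\<bar>) = integral X (\<lambda>x. \<bar>\<phi>' x - \<psi>' x\<bar>)"
    by (rule Henstock_Kurzweil_Integration.integral_cong) (simp add: assms)
  then show ?thesis unfolding delta_def using hgraph_cong[of X \<phi> \<phi>' \<psi> \<psi>'] assms by simp
qed

lemma delta_self: "X \<noteq> {} \<Longrightarrow> delta X \<phi> \<phi> = 0"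
  unfolding delta_def hgraph_def
  by (simp add: hausdorff_dist_self[OF closure_graph_on_nonempty])

lemma delta_bounds:
  fixes X :: "'a::euclidean_space set"
  assumes "X \<noteq> {}" "open X" "bounded X" "L-lipschitz_on X \<phi>" "L'-lipschitz_on X \<psi>"
  shows "0 \<le> integral X (\<lambda>x. \<bar>\<phi> x - \<psi> x\<bar>)" "0 \<le> hgraph X \<phi> \<psi>"
    "integral X (\<lambda>x. \<bar>\<phi> x - \<psi> x\<bar>) \<le> delta X \<phi> \<psi>" "hgraph X \<phi> \<psi> \<le> delta X \<phi> \<psi>"
    "0 \<le> delta X \<phi> \<psi>"
proof -
  show 1: "0 \<le> integral X (\<lambda>x. \<bar>\<phi> x - \<psi> x\<bar>)"
    by (rule integral_nonneg[OF integrable_abs_diff[OF assms(2-5)]]) auto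
  show 2: "0 \<le> hgraph X \<phi> \<psi>"
    by (intro hgraph_nonneg assms lipschitz_on_bounded_image[OF assms(3,4)])
  show "integral X (\<lambda>x. \<bar>\<phi> x - \<psi> x\<bar>) \<le> delta X \<phi> \<psi>" "hgraph X \<phi> \<psi> \<le> delta X \<phi> \<psi>"
    "0 \<le> delta X \<phi> \<psi>"
    unfolding delta_def using 1 2 by auto
qed

lemma delta_triangle:
  fixes X :: "'a::euclidean_space set"
  assumes X: "X \<noteq> {}" "open X" "bounded X"
    and L: "L-lipschitz_on X \<phi>" "L'-lipschitz_on X \<psi>" "L''-lipschitz_on X \<theta>"
  shows "delta X \<phi> \<theta> \<le> delta X \<phi> \<psi> + delta X \<psi> \<theta>"
proof -
  have i1: "(\<lambda>x. \<bar>\<phi> x - \<psi> x\<bar>) integrable_on X" "(\<lambda>x. \<bar>\<psi> x - \<theta> x\<bar>) integrable_on X"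
    "(\<lambda>x. \<bar>\<phi> x - \<theta> x\<bar>) integrable_on X"
    by (rule integrable_abs_diff[OF X(2,3) L(1,2)] integrable_abs_diff[OF X(2,3) L(2,3)]
        integrable_abs_diff[OF X(2,3) L(1,3)])+
  have "integral X (\<lambda>x. \<bar>\<phi> x - \<theta> x\<bar>) \<le> integral X (\<lambda>x. \<bar>\<phi> x - \<psi> x\<bar> + \<bar>\<psi> x - \<theta> x\<bar>)"
    by (rule integral_le) (use i1 in \<open>auto intro: integrable_add\<close>)
  also have "\<dots> = integral X (\<lambda>x. \<bar>\<phi> x - \<psi> x\<bar>) + integral X (\<lambda>x. \<bar>\<psi> x - \<theta> x\<bar>)"
    using i1 by (intro Henstock_Kurzweil_Integration.integral_add)
  moreover have "hgraph X \<phi> \<theta> \<le> hgraph X \<phi> \<psi> + hgraph X \<psi> \<theta>"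
    by (intro hgraph_triangle X L[THEN lipschitz_on_bounded_image[OF X(3)]])
  ultimately show ?thesis unfolding delta_def by linarith
qed

lemma delta_le_of_abs_diff_le:
  fixes X :: "'a::euclidean_space set"
  assumes X: "X \<noteq> {}" "open X" "bounded X"
    and L: "L-lipschitz_on X \<phi>" "L'-lipschitz_on X \<psi>"
    and e: "\<And>x. x \<in> X \<Longrightarrow> \<bar>\<phi> x - \<psi> x\<bar> \<le> e"
  shows "delta X \<phi> \<psi> \<le> (1 + measure lebesgue X) * e"
proof -
  have m: "X \<in> lmeasurable" using X lmeasurable_open by blast
  have e0: "0 \<le> e" using e X(1) by fastforce
  have "hgraph X \<phi> \<psi> \<le> 0 + e"
    by (rule hgraph_leI[OF X(1)]) (use e in \<open>force simp: abs_minus_commute\<close>)+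
  moreover have "integral X (\<lambda>x. \<bar>\<phi> x - \<psi> x\<bar>) \<le> integral X (\<lambda>x. e)"
    by (rule integral_le[OF integrable_abs_diff[OF X(2,3) L] integrable_on_const[OF m] e])
  moreover have "integral X (\<lambda>x. e) = measure lebesgue X * e"
    using lmeasure_integral[OF m] integral_mult_left[of X "\<lambda>_. 1" e] m integrable_on_const[OF m, of 1]
    by simp
  ultimately show ?thesis unfolding delta_def by (simp add: algebra_simps)
qed

section \<open>Lipschitz envelopes\<close>

text \<open>At continuity points an inequality almost everywhere becomes an inequality everywhere, so
  the envelopes of \<open>f\<close> are inf- and sup-convolutions over its (dense) set of continuity points.\<close>

definition lenv :: "'a::metric_space set \<Rightarrow> ('a \<Rightarrow> real) \<Rightarrow> real \<Rightarrow> 'a \<Rightarrow> real" where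
  "lenv C f k x = (INF c\<in>C. f c + k * dist x c)"

text \<open>Defined by negation so that each fact about \<open>lenv\<close> yields its dual when
  applied to the negated function.\<close>

definition uenv :: "'a::metric_space set \<Rightarrow> ('a \<Rightarrow> real) \<Rightarrow> real \<Rightarrow> 'a \<Rightarrow> real" where
  "uenv C f k x = - lenv C (\<lambda>c. - f c) k x"

locale bounded_fun =
  fixes C :: "'a::metric_space set" and f :: "'a \<Rightarrow> real" and M :: real
  assumes nonempty: "C \<noteq> {}"
    and bound: "\<And>c. c \<in> C \<Longrightarrow> \<bar>f c\<bar> \<le> M"
begin

lemma uminus: "bounded_fun C (\<lambda>c. - f c) M"
  by unfold_locales (use nonempty bound in auto)

lemma bdd_below_lenv:
  assumes "0 \<le> k"
  shows "bdd_below ((\<lambda>c. f c + k * dist x c) ` C)"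
proof (rule bdd_belowI2)
  show "- M \<le> f c + k * dist x c" if "c \<in> C" for c
    using bound[OF that] assms by (smt (verit) mult_nonneg_nonneg zero_le_dist)
qed

lemma lenv_le: "0 \<le> k \<Longrightarrow> c \<in> C \<Longrightarrow> lenv C f k x \<le> f c + k * dist x c"
  unfolding lenv_def using bdd_below_lenv by (rule cINF_lower)

lemma lenv_ge: "(\<And>c. c \<in> C \<Longrightarrow> a \<le> f c + k * dist x c) \<Longrightarrow> a \<le> lenv C f k x"
  unfolding lenv_def using nonempty by (rule cINF_greatest)

lemma lenv_lessD:
  assumes "lenv C f k x < a"
  obtains c where "c \<in> C" "f c + k * dist x c < a"
  using assms lenv_ge[of a k x] by (meson not_le)

lemma lenv_mono:
  assumes "0 \<le> k" "k \<le> k'"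
  shows "lenv C f k x \<le> lenv C f k' x"
proof (rule lenv_ge)
  show "lenv C f k x \<le> f c + k' * dist x c" if "c \<in> C" for c
    using lenv_le[OF assms(1) that, of x] mult_right_mono[OF assms(2), of "dist x c"] by simp
qed

lemma lenv_diff_le:
  assumes "0 \<le> k"
  shows "lenv C f k x \<le> lenv C f k y + k * dist x y"
proof -
  have "lenv C f k x - k * dist x y \<le> lenv C f k y"
  proof (rule lenv_ge)
    fix c assume c: "c \<in> C"
    have "k * dist x c \<le> k * (dist x y + dist y c)"
      using assms dist_triangle by (intro mult_left_mono) auto
    then show "lenv C f k x - k * dist x y \<le> f c + k * dist y c"
      using lenv_le[OF assms c, of x] by (simp add: algebra_simps)
  qed
  then show ?thesis by simp
qed

lemma lipschitz_lenv:
  assumes "0 \<le> k"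
  shows "k-lipschitz_on X (lenv C f k)"
proof (rule lipschitz_onI[OF _ assms])
  show "dist (lenv C f k x) (lenv C f k y) \<le> k * dist x y" for x y
    using lenv_diff_le[OF assms, of x y] lenv_diff_le[OF assms, of y x]
    by (simp add: dist_real_def dist_commute abs_le_iff)
qed

lemma lenv_ge_bound: "0 \<le> k \<Longrightarrow> - M \<le> lenv C f k x"
  using bound by (intro lenv_ge) (smt (verit) mult_nonneg_nonneg zero_le_dist)

lemma lenv_le_fun: "0 \<le> k \<Longrightarrow> c \<in> C \<Longrightarrow> lenv C f k c \<le> f c"
  using lenv_le[of k c c] by simp

lemma le_lenv_lipschitz:
  assumes "k-lipschitz_on X \<phi>" "x \<in> X" "C \<subseteq> X" "\<And>c. c \<in> C \<Longrightarrow> \<phi> c \<le> f c"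
  shows "\<phi> x \<le> lenv C f k x"
proof (rule lenv_ge)
  fix c assume c: "c \<in> C"
  have "\<phi> x - \<phi> c \<le> k * dist x c"
    using lipschitz_onD[OF assms(1,2), of c] c assms(3) by (auto simp: dist_real_def)
  then show "\<phi> x \<le> f c + k * dist x c" using assms(4)[OF c] by linarith
qed

text \<open>The values of \<open>f\<close> on \<open>C\<close> vary by at most \<open>2 * M\<close>,
  so a point at distance \<open>r\<close> or more pays too much to push the infimum below
  \<open>a\<close>.\<close>

lemma lenv_ge_local:
  assumes "0 \<le> k" "2 * M \<le> k * r" "a \<le> M" "\<And>c. c \<in> C \<Longrightarrow> dist x c < r \<Longrightarrow> a \<le> f c"
  shows "a \<le> lenv C f k x"
proof (rule lenv_ge)
  fix c assume c: "c \<in> C"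
  show "a \<le> f c + k * dist x c"
  proof (cases "dist x c < r")
    case True
    then show ?thesis using assms(4)[OF c True] assms(1) by (smt (verit) mult_nonneg_nonneg zero_le_dist)
  next
    case False
    then have "k * r \<le> k * dist x c" using assms(1) by (intro mult_left_mono) auto
    then show ?thesis using assms bound[OF c] by linarith
  qed
qed

end

text \<open>\<open>C\<close> stays abstract because it is used with two meanings: the continuity
  points of \<open>f\<close>, and all of \<open>X\<close> for the continuous approximant.\<close>

locale dense_fun = bounded_fun C f M for C :: "'a::metric_space set" and f M +
  fixes X :: "'a set"
  assumes subset: "C \<subseteq> X"
    and dense: "X \<subseteq> closure C"
begin

lemma uminus: "dense_fun C (\<lambda>c. - f c) M X"
  using uminus subset dense by (simp add: dense_fun_def dense_fun_axioms_def)

lemma near: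
  assumes "x \<in> X" "0 < r"
  obtains c where "c \<in> C" "dist x c < r"
  using assms dense closure_approachable[of x C] by (metis dist_commute subsetD)

lemma continuous_le_of_dense:
  assumes "continuous_on X \<phi>" "continuous_on X \<psi>" "x \<in> X"
    and "\<And>c. c \<in> C \<Longrightarrow> \<phi> c \<le> (\<psi> c :: real)"
  shows "\<phi> x \<le> \<psi> x"
proof -
  have "x \<in> closure C" using assms(3) dense by auto
  then obtain c where c: "\<And>n. c n \<in> C" "c \<longlonglongrightarrow> x" unfolding closure_sequential by auto
  have "(\<lambda>n. \<phi> (c n)) \<longlonglongrightarrow> \<phi> x" "(\<lambda>n. \<psi> (c n)) \<longlonglongrightarrow> \<psi> x"
    using c(1) subset
    by (auto intro!: continuous_on_tendsto_compose[OF _ c(2) assms(3)] assms(1,2) always_eventually)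
  then show ?thesis using assms(4)[OF c(1)] by (intro LIMSEQ_le) auto
qed

lemma continuous_lenv: "0 \<le> k \<Longrightarrow> continuous_on X (lenv C f k)"
  by (rule lipschitz_on_continuous_on[OF lipschitz_lenv])

lemma lenv_le_bound: "0 \<le> k \<Longrightarrow> x \<in> X \<Longrightarrow> lenv C f k x \<le> M"
  using continuous_le_of_dense[OF continuous_lenv continuous_on_const, of k x M]
    lenv_le_fun[of k] bound by (smt (verit) abs_le_D1)

lemma abs_lenv_le: "0 \<le> k \<Longrightarrow> x \<in> X \<Longrightarrow> \<bar>lenv C f k x\<bar> \<le> M"
  using lenv_le_bound lenv_ge_bound by (simp add: abs_le_iff minus_le_iff)

end

context dense_fun
begin

interpretation neg: dense_fun C "\<lambda>c. - f c" M X
  by (rule uminus)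

lemma continuous_uenv: "0 \<le> k \<Longrightarrow> continuous_on X (uenv C f k)"
  unfolding uenv_def by (intro continuous_intros neg.continuous_lenv)

lemma uenv_antimono: "0 \<le> k \<Longrightarrow> k \<le> k' \<Longrightarrow> uenv C f k' x \<le> uenv C f k x"
  unfolding uenv_def using neg.lenv_mono by simp

lemma lenv_le_fun_le_uenv:
  "0 \<le> k \<Longrightarrow> 0 \<le> k' \<Longrightarrow> c \<in> C \<Longrightarrow> lenv C f k c \<le> f c \<and> f c \<le> uenv C f k' c"
  using lenv_le_fun neg.lenv_le_fun[of k' c] by (simp add: uenv_def)

lemma lenv_le_uenv: "0 \<le> k \<Longrightarrow> 0 \<le> k' \<Longrightarrow> x \<in> X \<Longrightarrow> lenv C f k x \<le> uenv C f k' x"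
  by (rule continuous_le_of_dense[OF continuous_lenv continuous_uenv])
    (use lenv_le_fun_le_uenv[of k k'] in fastforce)+

end

text \<open>Continuity bounds \<open>f\<close> from below on a ball of radius \<open>r\<close>
  around \<open>c\<close>, and slopes from \<open>2 * M / r\<close> on make the points outside
  irrelevant.\<close>

lemma (in bounded_fun) eventually_lenv_ge:
  assumes c: "c \<in> X" and cont: "continuous (at c within X) f" and "C \<subseteq> X" "0 < e" "c \<in> C"
  shows "\<exists>n::nat. \<forall>k\<ge>real n. f c - e \<le> lenv C f k c"
proof -
  obtain r where r: "0 < r" "\<And>y. y \<in> X \<Longrightarrow> dist y c < r \<Longrightarrow> dist (f y) (f c) < e"
    using cont assms(4) unfolding continuous_within_eps_delta by blast
  obtain n :: nat where n: "2 * M / r \<le> n" using real_arch_simple by blast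
  have "f c - e \<le> lenv C f k c" if "real n \<le> k" for k
  proof (rule lenv_ge_local[of k r])
    have "2 * M / r \<le> k" using n that by linarith
    then show "2 * M \<le> k * r" using r(1) by (simp add: pos_divide_le_eq)
    show "f c - e \<le> M" using bound[OF assms(5)] assms(4) by linarith
    show "f c - e \<le> f y" if "y \<in> C" "dist c y < r" for y
      using r(2)[of y] that assms(3) by (auto simp: dist_commute dist_real_def abs_if split: if_splits)
  qed (use that in linarith)
  then show ?thesis by blast
qed

section \<open>Envelopes and continuity points\<close>

lemma AE_imp_dense:
  fixes U :: "'a::euclidean_space set"
  assumes "AE x in lebesgue. P x" "open U" "U \<noteq> {}"
  shows "\<exists>x\<in>U. P x"
proof (rule ccontr)
  assume "\<not> ?thesis"
  then have "AE x in lebesgue. x \<notin> U" using assms(1) by (auto elim: eventually_mono)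
  then have "negligible U"
    using AE_iff_null_sets[of U lebesgue] assms(2) by (auto simp: negligible_iff_null_sets)
  then show False using assms(2,3) open_not_negligible by blast
qed

definition cpts :: "'a::t2_space set \<Rightarrow> ('a \<Rightarrow> 'b::topological_space) \<Rightarrow> 'a set" where
  "cpts X f = {x \<in> X. continuous (at x within X) f}"

lemma dense_cpts:
  fixes X :: "'a::euclidean_space set"
  assumes "open X" "f \<in> Cae X"
  shows "X \<subseteq> closure (cpts X f)"
proof
  fix x assume x: "x \<in> X"
  show "x \<in> closure (cpts X f)"
    unfolding closure_approachable
  proof (intro allI impI)
    fix e :: real assume "0 < e"
    have "\<exists>y\<in>X \<inter> ball x e. y \<in> X \<longrightarrow> continuous (at y within X) f"
      by (rule AE_imp_dense) (use assms x \<open>0 < e\<close> in \<open>auto simp: Cae_def\<close>)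
    then show "\<exists>y\<in>cpts X f. dist y x < e" by (auto simp: cpts_def dist_commute)
  qed
qed

text \<open>The lower bound 1 on \<open>M\<close> later allows errors \<open>eps \<le> 1\<close> to
  be absorbed into \<open>M\<close>.\<close>

lemma Cae_bound:
  assumes "f \<in> Cae X"
  obtains M where "1 \<le> M" "\<And>x. x \<in> X \<Longrightarrow> \<bar>f x\<bar> \<le> M"
proof -
  obtain B where "\<And>x. x \<in> X \<Longrightarrow> \<bar>f x\<bar> \<le> B" using assms by (auto simp: Cae_def bounded_iff)
  then show ?thesis using that[of "max 1 B"] by (auto simp: le_max_iff_disj)
qed

lemma dense_fun_Cae:
  fixes X :: "'a::euclidean_space set"
  assumes "open X" "X \<noteq> {}" "f \<in> Cae X" "\<And>x. x \<in> X \<Longrightarrow> \<bar>f x\<bar> \<le> M"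
  shows "dense_fun (cpts X f) f M X"
proof
  show "X \<subseteq> closure (cpts X f)" using dense_cpts assms by blast
  then show "cpts X f \<noteq> {}" using assms(2) by auto
qed (use assms in \<open>auto simp: cpts_def\<close>)

text \<open>A strict violation at a continuity point would persist on a neighbourhood, which is not
  negligible.\<close>

lemma ae_le_cpts:
  fixes X :: "'a::euclidean_space set"
  assumes "open X" "ae_le X \<phi> f" "continuous_on X \<phi>" "c \<in> cpts X f"
  shows "\<phi> c \<le> f c"
proof (rule ccontr)
  assume "\<not> ?thesis"
  then have pos: "0 < \<phi> c - f c" by simp
  have c: "c \<in> X" "continuous (at c within X) f" using assms(4) by (auto simp: cpts_def)
  have "continuous (at c within X) (\<lambda>x. \<phi> x - f x)"
    using assms(3) c by (intro continuous_intros) (auto simp: continuous_on_eq_continuous_within)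
  then have "((\<lambda>x. \<phi> x - f x) \<longlongrightarrow> \<phi> c - f c) (at c within X)"
    unfolding continuous_within .
  then have "\<forall>\<^sub>F x in at c within X. 0 < \<phi> x - f x" using pos by (rule order_tendstoD)
  then obtain r where r: "0 < r" "\<And>y. y \<in> X \<Longrightarrow> y \<noteq> c \<Longrightarrow> dist y c < r \<Longrightarrow> 0 < \<phi> y - f y"
    unfolding eventually_at by blast
  have "\<exists>y\<in>X \<inter> ball c r. y \<in> X \<longrightarrow> \<phi> y \<le> f y"
    by (rule AE_imp_dense) (use assms c r in \<open>auto simp: ae_le_def\<close>)
  then obtain y where "y \<in> X" "dist y c < r" "\<phi> y \<le> f y" by (auto simp: dist_commute)
  then show False using r(2)[of y] pos by fastforce
qed

lemma AE_cpts: "f \<in> Cae X \<Longrightarrow> AE x in lebesgue. x \<in> X \<longrightarrow> x \<in> cpts X f"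
  by (auto simp: Cae_def cpts_def)

text \<open>The supremum is a maximum: \<open>lenv\<close> is itself a competitor, since almost
  every point of \<open>X\<close> is a continuity point, and every competitor lies below it.\<close>

lemma lower_env_eq_lenv:
  fixes X :: "'a::euclidean_space set"
  assumes "open X" "X \<noteq> {}" "f \<in> Cae X" "x \<in> X"
  shows "lower_env X k f x = lenv (cpts X f) f (real k) x"
proof -
  obtain M where M: "\<And>x. x \<in> X \<Longrightarrow> \<bar>f x\<bar> \<le> M" using Cae_bound[OF assms(3)] by metis
  interpret dense_fun "cpts X f" f M X using dense_fun_Cae assms M by blast
  show ?thesis unfolding lower_env_def
  proof (rule cSup_eq_maximum)
    have "AE c in lebesgue. c \<in> X \<longrightarrow> lenv (cpts X f) f k c \<le> f c"
      using AE_cpts[OF assms(3)] by eventually_elim (simp add: lenv_le_fun)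
    then show "lenv (cpts X f) f k x \<in> {\<phi> x |\<phi>. (real k)-lipschitz_on X \<phi> \<and> ae_le X \<phi> f}"
      using lipschitz_lenv[of "real k" X] by (auto simp: ae_le_def)
    show "y \<le> lenv (cpts X f) f k x"
      if "y \<in> {\<phi> x |\<phi>. (real k)-lipschitz_on X \<phi> \<and> ae_le X \<phi> f}" for y
      using that le_lenv_lipschitz[OF _ assms(4) subset] ae_le_cpts[OF assms(1)]
        lipschitz_on_continuous_on by blast
  qed
qed

text \<open>Holds for arbitrary \<open>f\<close>: \<open>Inf\<close> on the reals is the negated
  \<open>Sup\<close> of the negated set, so even unspecified values agree.\<close>

lemma upper_env_eq_lower_env: "upper_env X k f x = - lower_env X k (\<lambda>x. - f x) x"
proof -
  have "{\<phi> x |\<phi>. (real k)-lipschitz_on X \<phi> \<and> ae_le X \<phi> (\<lambda>x. - f x)}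
    = uminus ` {\<phi> x |\<phi>. (real k)-lipschitz_on X \<phi> \<and> ae_le X f \<phi>}" (is "?A = _ ` ?B")
  proof (intro set_eqI iffI)
    fix y assume "y \<in> ?A"
    then obtain \<phi> where \<phi>: "y = \<phi> x" "(real k)-lipschitz_on X \<phi>" "ae_le X \<phi> (\<lambda>x. - f x)" by auto
    have "(real k)-lipschitz_on X (\<lambda>x. - \<phi> x)" "ae_le X f (\<lambda>x. - \<phi> x)"
      using \<phi> lipschitz_on_minus by (auto simp: ae_le_def le_minus_iff)
    then have "- \<phi> x \<in> ?B" by (intro CollectI exI[of _ "\<lambda>x. - \<phi> x"] conjI refl)
    then show "y \<in> uminus ` ?B" unfolding \<phi>(1) by (rule rev_image_eqI) simp
  next
    fix y assume "y \<in> uminus ` ?B"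
    then obtain \<phi> where \<phi>: "y = - \<phi> x" "(real k)-lipschitz_on X \<phi>" "ae_le X f \<phi>" by auto
    have "(real k)-lipschitz_on X (\<lambda>x. - \<phi> x)" "ae_le X (\<lambda>x. - \<phi> x) (\<lambda>x. - f x)"
      using \<phi> lipschitz_on_minus by (auto simp: ae_le_def)
    then show "y \<in> ?A" unfolding \<phi>(1) by (intro CollectI exI[of _ "\<lambda>x. - \<phi> x"] conjI refl)
  qed
  then show ?thesis unfolding upper_env_def lower_env_def by (simp add: Inf_real_def)
qed

lemma Cae_uminus: "f \<in> Cae X \<Longrightarrow> (\<lambda>x. - f x) \<in> Cae X"
proof -
  assume f: "f \<in> Cae X"
  have "(\<lambda>x. - f x) ` X = uminus ` f ` X" by auto
  moreover have "bounded (uminus ` f ` X)" using f by (auto simp: Cae_def)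
  ultimately show ?thesis using f
    by (auto simp: Cae_def elim!: eventually_mono intro: continuous_minus)
qed

lemma cpts_uminus: "cpts X (\<lambda>x. - f x :: real) = cpts X f"
  unfolding cpts_def using continuous_minus[of _ f] continuous_minus[of _ "\<lambda>x. - f x"] by auto

lemma upper_env_eq_uenv:
  fixes X :: "'a::euclidean_space set"
  assumes "open X" "X \<noteq> {}" "f \<in> Cae X" "x \<in> X"
  shows "upper_env X k f x = uenv (cpts X f) f (real k) x"
  using lower_env_eq_lenv[OF assms(1,2) Cae_uminus[OF assms(3)] assms(4)]
  by (simp add: upper_env_eq_lower_env uenv_def cpts_uminus)

lemma lipschitz_lower_env:
  fixes X :: "'a::euclidean_space set"
  assumes "open X" "X \<noteq> {}" "f \<in> Cae X"
  shows "(real k)-lipschitz_on X (lower_env X k f)"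
proof -
  obtain M where M: "\<And>x. x \<in> X \<Longrightarrow> \<bar>f x\<bar> \<le> M" using Cae_bound[OF assms(3)] by metis
  interpret dense_fun "cpts X f" f M X using dense_fun_Cae assms M by blast
  show ?thesis
    using lipschitz_lenv[of "real k" X] lower_env_eq_lenv[OF assms] by (auto simp: lipschitz_on_def)
qed

lemma lipschitz_upper_env:
  fixes X :: "'a::euclidean_space set"
  assumes "open X" "X \<noteq> {}" "f \<in> Cae X"
  shows "(real k)-lipschitz_on X (upper_env X k f)"
  using lipschitz_on_minus[OF lipschitz_lower_env[OF assms(1,2) Cae_uminus[OF assms(3)]]]
  by (simp add: upper_env_eq_lower_env[abs_def])

section \<open>The metric r\<close>

text \<open>By dominated convergence the integrals tend to the integral of the pointwise limit,
  which is nonnegative and so has integral 0 exactly if it vanishes almost everywhere. One direction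
  gives small gaps for a given \<open>f\<close>, the other gives continuity of the limit of a Cauchy
  sequence.\<close>

lemma decreasing_integral_tendsto_0_iff:
  fixes X :: "'a::euclidean_space set" and w :: "nat \<Rightarrow> 'a \<Rightarrow> real"
  assumes X: "open X" "bounded X"
    and cont: "\<And>k. continuous_on X (w k)" and nonneg: "\<And>k x. x \<in> X \<Longrightarrow> 0 \<le> w k x"
    and decr: "\<And>k x. x \<in> X \<Longrightarrow> w (Suc k) x \<le> w k x" and bd: "bounded (w 0 ` X)"
  shows "(\<lambda>k. integral X (w k)) \<longlonglongrightarrow> 0 \<longleftrightarrow>
    (AE x in lebesgue. x \<in> X \<longrightarrow> (\<lambda>k. w k x) \<longlonglongrightarrow> 0)"
proof -
  define W where "W x = lim (\<lambda>k. w k x)" for x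
  have le0: "w k x \<le> w 0 x" if "x \<in> X" for k x
    using decseqD[OF decseq_SucI, of "\<lambda>k. w k x" 0 k] decr[OF that] by simp
  have lim: "(\<lambda>k. w k x) \<longlonglongrightarrow> W x" if x: "x \<in> X" for x
  proof -
    obtain L where "(\<lambda>k. w k x) \<longlonglongrightarrow> L"
      using decseq_convergent[of "\<lambda>k. w k x" 0] decseq_SucI[of "\<lambda>k. w k x"] nonneg[OF x] decr[OF x]
      by metis
    then show ?thesis unfolding W_def by (simp add: limI)
  qed
  have W0: "0 \<le> W x" if "x \<in> X" for x
    using LIMSEQ_le_const[OF lim[OF that]] nonneg[OF that] by blast
  obtain B where B: "\<And>x. x \<in> X \<Longrightarrow> \<bar>w 0 x\<bar> \<le> B" using bd by (auto simp: bounded_iff)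
  have wB: "norm (w k x) \<le> B" if "x \<in> X" for k x
    using le0[OF that, of k] nonneg[OF that, of k] B[OF that] by simp
  have m: "X \<in> lmeasurable" using X lmeasurable_open by blast
  have int: "w k integrable_on X" for k
    by (intro set_lebesgue_integral_eq_integral(1) continuous_bounded_integrable_on X cont)
      (use wB in \<open>auto simp: bounded_iff\<close>)
  have intW: "W integrable_on X" and limI: "(\<lambda>k. integral X (w k)) \<longlonglongrightarrow> integral X W"
    using dominated_convergence[OF int integrable_on_const[OF m] wB lim] by auto
  have absW: "W absolutely_integrable_on X"
    using nonnegative_absolutely_integrable_1[OF intW] W0 by blast
  have "integral X W = 0 \<longleftrightarrow> (AE x in lebesgue. indicat_real X x *\<^sub>R W x = 0)"
    unfolding set_lebesgue_integral_eq_integral(2)[OF absW, symmetric] set_lebesgue_integral_def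
    by (rule integral_nonneg_eq_0_iff_AE)
      (use absW W0 in \<open>auto simp: set_integrable_def indicator_def\<close>)
  also have "\<dots> \<longleftrightarrow> (AE x in lebesgue. x \<in> X \<longrightarrow> W x = 0)"
    by (simp add: indicator_def)
  also have "\<dots> \<longleftrightarrow> (AE x in lebesgue. x \<in> X \<longrightarrow> (\<lambda>k. w k x) \<longlonglongrightarrow> 0)"
    by (intro AE_cong) (use lim LIMSEQ_unique in metis)
  finally show ?thesis using limI LIMSEQ_unique[of _ "integral X W" 0] by metis
qed

lemma r_metric_le_iff:
  "r_metric X f g \<le> ereal e \<longleftrightarrow>
    (\<forall>k\<ge>1. delta X (lower_env X k f) (lower_env X k g) \<le> e \<and>
           delta X (upper_env X k f) (upper_env X k g) \<le> e)"
  unfolding r_metric_def SUP_le_iff by auto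

lemma delta_le_r_metric:
  assumes "1 \<le> k"
  shows "ereal (delta X (lower_env X k f) (lower_env X k g)) \<le> r_metric X f g"
    "ereal (delta X (upper_env X k f) (upper_env X k g)) \<le> r_metric X f g"
proof -
  have "ereal (max (delta X (lower_env X k f) (lower_env X k g))
      (delta X (upper_env X k f) (upper_env X k g))) \<le> r_metric X f g"
    unfolding r_metric_def using assms by (intro SUP_upper) auto
  then show "ereal (delta X (lower_env X k f) (lower_env X k g)) \<le> r_metric X f g"
    "ereal (delta X (upper_env X k f) (upper_env X k g)) \<le> r_metric X f g"
    by (meson ereal_less_eq(3) max.cobounded1 max.cobounded2 order_trans)+
qed

lemma r_metric_commute: "r_metric X f g = r_metric X g f"
  unfolding r_metric_def by (simp add: delta_commute)

lemma ae_eq_imp_env_eq: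
  assumes "ae_eq X f f'"
  shows "lower_env X k f = lower_env X k f'" "upper_env X k f = upper_env X k f'"
proof -
  have AE: "AE x in lebesgue. x \<in> X \<longrightarrow> f x = f' x" using assms by (simp add: ae_eq_def)
  have "ae_le X \<phi> f \<longleftrightarrow> ae_le X \<phi> f'" for \<phi>
    unfolding ae_le_def by (rule eventually_subst) (use AE in \<open>eventually_elim, auto\<close>)
  moreover have "ae_le X f \<phi> \<longleftrightarrow> ae_le X f' \<phi>" for \<phi>
    unfolding ae_le_def by (rule eventually_subst) (use AE in \<open>eventually_elim, auto\<close>)
  ultimately show "lower_env X k f = lower_env X k f'" "upper_env X k f = upper_env X k f'"
    unfolding lower_env_def upper_env_def by auto
qed

lemma r_metric_cong: "ae_eq X f f' \<Longrightarrow> r_metric X f g = r_metric X f' g"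
  unfolding r_metric_def by (simp add: ae_eq_imp_env_eq)

lemma r_metric_self: "X \<noteq> {} \<Longrightarrow> r_metric X f f = 0"
  unfolding r_metric_def by (simp add: delta_self zero_ereal_def)

section \<open>Metric properties on a bounded open domain\<close>

locale domain =
  fixes X :: "'a::euclidean_space set"
  assumes X_nonempty: "X \<noteq> {}" and op: "open X" and bdd: "bounded X"
begin

lemmas lipschitz_lower = lipschitz_lower_env[OF op X_nonempty]
lemmas lipschitz_upper = lipschitz_upper_env[OF op X_nonempty]

lemma abs_lower_env_le:
  assumes "f \<in> Cae X" "\<And>x. x \<in> X \<Longrightarrow> \<bar>f x\<bar> \<le> M" "x \<in> X"
  shows "\<bar>lower_env X k f x\<bar> \<le> M"
proof -
  interpret dense_fun "cpts X f" f M X using dense_fun_Cae op X_nonempty assms by blast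
  show ?thesis using abs_lenv_le[of "real k" x] lower_env_eq_lenv[OF op X_nonempty assms(1,3)] assms(3)
    by simp
qed

lemma abs_upper_env_le:
  assumes "f \<in> Cae X" "\<And>x. x \<in> X \<Longrightarrow> \<bar>f x\<bar> \<le> M" "x \<in> X"
  shows "\<bar>upper_env X k f x\<bar> \<le> M"
  using abs_lower_env_le[OF Cae_uminus[OF assms(1)]] assms by (simp add: upper_env_eq_lower_env)

lemma lower_env_mono:
  assumes "f \<in> Cae X" "x \<in> X" "k \<le> k'"
  shows "lower_env X k f x \<le> lower_env X k' f x"
proof -
  obtain M where M: "\<And>x. x \<in> X \<Longrightarrow> \<bar>f x\<bar> \<le> M" using Cae_bound[OF assms(1)] by metis
  interpret dense_fun "cpts X f" f M X using dense_fun_Cae op X_nonempty assms M by blast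
  show ?thesis using lenv_mono[of "real k" "real k'" x] lower_env_eq_lenv[OF op X_nonempty assms(1,2)]
      assms(3) by simp
qed

lemma upper_env_antimono:
  "f \<in> Cae X \<Longrightarrow> x \<in> X \<Longrightarrow> k \<le> k' \<Longrightarrow> upper_env X k' f x \<le> upper_env X k f x"
  using lower_env_mono[OF Cae_uminus] by (simp add: upper_env_eq_lower_env)

lemma lower_le_upper:
  assumes "f \<in> Cae X" "x \<in> X"
  shows "lower_env X k f x \<le> upper_env X k' f x"
proof -
  obtain M where M: "\<And>x. x \<in> X \<Longrightarrow> \<bar>f x\<bar> \<le> M" using Cae_bound[OF assms(1)] by metis
  interpret dense_fun "cpts X f" f M X using dense_fun_Cae op X_nonempty assms M by blast
  show ?thesis using lenv_le_uenv[of "real k" "real k'" x] assms(2)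
      lower_env_eq_lenv[OF op X_nonempty assms] upper_env_eq_uenv[OF op X_nonempty assms] by simp
qed

lemma lower_env_le_fun:
  assumes "f \<in> Cae X" "c \<in> cpts X f"
  shows "lower_env X k f c \<le> f c"
proof -
  obtain M where M: "\<And>x. x \<in> X \<Longrightarrow> \<bar>f x\<bar> \<le> M" using Cae_bound[OF assms(1)] by metis
  interpret dense_fun "cpts X f" f M X using dense_fun_Cae op X_nonempty assms M by blast
  show ?thesis using lenv_le_fun[of "real k" c] assms subset
    lower_env_eq_lenv[OF op X_nonempty assms(1), of c] by auto
qed

lemma lower_env_tendsto:
  assumes "f \<in> Cae X" "c \<in> cpts X f"
  shows "(\<lambda>k. lower_env X k f c) \<longlonglongrightarrow> f c"
proof (rule LIMSEQ_I)
  obtain M where M: "\<And>x. x \<in> X \<Longrightarrow> \<bar>f x\<bar> \<le> M" using Cae_bound[OF assms(1)] by metis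
  interpret dense_fun "cpts X f" f M X using dense_fun_Cae op X_nonempty assms M by blast
  have c: "c \<in> X" "continuous (at c within X) f" using assms(2) by (auto simp: cpts_def)
  fix e :: real assume e: "0 < e"
  then obtain n where n: "\<forall>k\<ge>real n. f c - e / 2 \<le> lenv (cpts X f) f k c"
    using eventually_lenv_ge[OF c subset _ assms(2), of "e / 2"] by auto
  have "norm (lower_env X k f c - f c) < e" if "n \<le> k" for k
    using n[rule_format, of "real k"] that e lower_env_eq_lenv[OF op X_nonempty assms(1) c(1), of k]
      lower_env_le_fun[OF assms, of k] by simp
  then show "\<exists>n. \<forall>k\<ge>n. norm (lower_env X k f c - f c) < e" by blast
qed

lemma upper_env_tendsto:
  assumes "f \<in> Cae X" "c \<in> cpts X f"
  shows "(\<lambda>k. upper_env X k f c) \<longlonglongrightarrow> f c"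
  using tendsto_minus[OF lower_env_tendsto[OF Cae_uminus[OF assms(1)], of c]] assms
  by (simp add: upper_env_eq_lower_env cpts_uminus)

text \<open>Envelopes inherit the bounds of their functions, which gives an estimate independent of
  \<open>k\<close>.\<close>

lemma r_metric_finite:
  assumes f: "f \<in> Cae X" and g: "g \<in> Cae X"
  shows "r_metric X f g < \<infinity>"
proof -
  obtain M where M: "\<And>x. x \<in> X \<Longrightarrow> \<bar>f x\<bar> \<le> M" using Cae_bound[OF f] by metis
  obtain N where N: "\<And>x. x \<in> X \<Longrightarrow> \<bar>g x\<bar> \<le> N" using Cae_bound[OF g] by metis
  have "r_metric X f g \<le> ereal ((1 + measure lebesgue X) * (M + N))"
    unfolding r_metric_le_iff
  proof (intro allI impI conjI)
    fix k
    show "delta X (lower_env X k f) (lower_env X k g) \<le> (1 + measure lebesgue X) * (M + N)"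
    proof (rule delta_le_of_abs_diff_le[OF X_nonempty op bdd lipschitz_lower[OF f] lipschitz_lower[OF g]])
      show "\<bar>lower_env X k f x - lower_env X k g x\<bar> \<le> M + N" if "x \<in> X" for x
        using abs_lower_env_le[OF f M that, of k] abs_lower_env_le[OF g N that, of k] by linarith
    qed
    show "delta X (upper_env X k f) (upper_env X k g) \<le> (1 + measure lebesgue X) * (M + N)"
    proof (rule delta_le_of_abs_diff_le[OF X_nonempty op bdd lipschitz_upper[OF f] lipschitz_upper[OF g]])
      show "\<bar>upper_env X k f x - upper_env X k g x\<bar> \<le> M + N" if "x \<in> X" for x
        using abs_upper_env_le[OF f M that, of k] abs_upper_env_le[OF g N that, of k] by linarith
    qed
  qed
  then show ?thesis by (rule order_le_less_trans) simp
qed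

lemma lipschitz_eq_of_delta_0:
  assumes "L-lipschitz_on X \<phi>" "L-lipschitz_on X \<psi>" "delta X \<phi> \<psi> \<le> 0" "x \<in> X"
  shows "\<phi> x = \<psi> x"
proof (rule ccontr)
  assume ne: "\<phi> x \<noteq> \<psi> x"
  have L: "0 \<le> L" using assms(1) by (rule lipschitz_on_nonneg)
  define e where "e = \<bar>\<phi> x - \<psi> x\<bar> / (1 + L)"
  have "0 < e" using ne L by (simp add: e_def)
  then have "hgraph X \<phi> \<psi> < e"
    using delta_bounds(4)[OF X_nonempty op bdd assms(1,2)] assms(3) by linarith
  from lipschitz_abs_diff_less[OF bdd assms(1,2) this assms(4)] show False
    using L by (simp add: e_def)
qed

text \<open>If \<open>r\<close> vanishes, the lower envelopes agree on \<open>X\<close> for all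
  \<open>k \<ge> 1\<close>, and at common continuity points, that is almost everywhere, they
  converge to both functions.\<close>

lemma r_metric_eq_0_iff:
  assumes f: "f \<in> Cae X" and g: "g \<in> Cae X"
  shows "r_metric X f g = 0 \<longleftrightarrow> ae_eq X f g"
proof
  assume "ae_eq X f g"
  then show "r_metric X f g = 0" using r_metric_cong[of X f g g] r_metric_self X_nonempty by simp
next
  assume "r_metric X f g = 0"
  then have d: "delta X (lower_env X k f) (lower_env X k g) \<le> 0" if "1 \<le> k" for k
    using delta_le_r_metric(1)[OF that, of X f g] by (simp add: zero_ereal_def)
  have eq: "lower_env X k f x = lower_env X k g x" if "1 \<le> k" "x \<in> X" for k x
    using lipschitz_eq_of_delta_0[OF lipschitz_lower[OF f] lipschitz_lower[OF g] d[OF that(1)] that(2)] .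
  have fg: "f x = g x" if "x \<in> cpts X f" "x \<in> cpts X g" for x
  proof (rule LIMSEQ_unique[OF lower_env_tendsto[OF f that(1)]])
    have "\<forall>\<^sub>F k in sequentially. lower_env X k g x = lower_env X k f x"
      using eventually_ge_at_top[of 1] by eventually_elim (use eq that in \<open>simp add: cpts_def\<close>)
    then show "(\<lambda>k. lower_env X k f x) \<longlonglongrightarrow> g x"
      using Lim_transform_eventually[OF lower_env_tendsto[OF g that(2)]] by simp
  qed
  show "ae_eq X f g"
    unfolding ae_eq_def using AE_cpts[OF f] AE_cpts[OF g] by eventually_elim (use fg in auto)
qed

lemma r_metric_triangle:
  assumes f: "f \<in> Cae X" and g: "g \<in> Cae X" and h: "h \<in> Cae X"
  shows "r_metric X f h \<le> r_metric X f g + r_metric X g h"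
  unfolding r_metric_def[of X f h]
proof (rule SUP_least)
  fix k :: nat assume "k \<in> {1..}"
  then have k: "1 \<le> k" by simp
  have "ereal (delta X (lower_env X k f) (lower_env X k h)) \<le> r_metric X f g + r_metric X g h"
    using delta_triangle[OF X_nonempty op bdd lipschitz_lower[OF f] lipschitz_lower[OF g] lipschitz_lower[OF h], of k k k]
      add_mono[OF delta_le_r_metric(1)[OF k, of X f g] delta_le_r_metric(1)[OF k, of X g h]]
    by (metis (no_types, lifting) ereal_less_eq(3) order_trans plus_ereal.simps(1))
  moreover have "ereal (delta X (upper_env X k f) (upper_env X k h)) \<le> r_metric X f g + r_metric X g h"
    using delta_triangle[OF X_nonempty op bdd lipschitz_upper[OF f] lipschitz_upper[OF g] lipschitz_upper[OF h], of k k k]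
      add_mono[OF delta_le_r_metric(2)[OF k, of X f g] delta_le_r_metric(2)[OF k, of X g h]]
    by (metis (no_types, lifting) ereal_less_eq(3) order_trans plus_ereal.simps(1))
  ultimately show "ereal (max (delta X (lower_env X k f) (lower_env X k h))
      (delta X (upper_env X k f) (upper_env X k h))) \<le> r_metric X f g + r_metric X g h"
    by (simp add: max_def)
qed

end

section \<open>Completeness\<close>

context domain
begin

text \<open>The last conjunct hands the Cauchy tolerance to the limit with the same
  \<open>N\<close>. An \<open>N\<close> that serves all slopes for the sequence therefore serves all
  slopes for the limits, although the uniform convergence used in the proof depends on
  \<open>L\<close>.\<close>

lemma delta_Cauchy_limit:
  assumes lip: "\<And>n. L-lipschitz_on X (a n)"
    and Cauchy: "\<And>e. 0 < e \<Longrightarrow> \<exists>N. \<forall>m\<ge>N. \<forall>n\<ge>N. delta X (a m) (a n) < e"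
  shows "\<exists>b. L-lipschitz_on X b \<and> (\<forall>x\<in>X. (\<lambda>n. a n x) \<longlonglongrightarrow> b x) \<and>
    (\<forall>N e. (\<forall>m\<ge>N. \<forall>n\<ge>N. delta X (a m) (a n) \<le> e) \<longrightarrow> (\<forall>n\<ge>N. delta X (a n) b \<le> e))"
proof -
  define b where "b x = lim (\<lambda>n. a n x)" for x
  have L: "0 \<le> L" using lip by (rule lipschitz_on_nonneg)
  have unif: "\<exists>N. \<forall>m\<ge>N. \<forall>n\<ge>N. \<forall>x\<in>X. \<bar>a m x - a n x\<bar> < e" if e: "0 < e" for e
  proof -
    have "0 < e / (1 + L)" using e L by simp
    then obtain N where N: "\<And>m n. N \<le> m \<Longrightarrow> N \<le> n \<Longrightarrow> delta X (a m) (a n) < e / (1 + L)"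
      using Cauchy by blast
    have "\<bar>a m x - a n x\<bar> < e" if "N \<le> m" "N \<le> n" "x \<in> X" for m n x
    proof -
      have "hgraph X (a m) (a n) < e / (1 + L)"
        using delta_bounds(4)[OF X_nonempty op bdd lip lip, of m n] N[OF that(1,2)] by linarith
      from lipschitz_abs_diff_less[OF bdd lip lip this that(3)] show ?thesis using L by simp
    qed
    then show ?thesis by blast
  qed
  have lim: "(\<lambda>n. a n x) \<longlonglongrightarrow> b x" if "x \<in> X" for x
  proof -
    have "Cauchy (\<lambda>n. a n x)"
      by (rule metric_CauchyI) (use unif that in \<open>fastforce simp: dist_real_def\<close>)
    then show ?thesis unfolding b_def by (simp add: Cauchy_convergent_iff convergent_LIMSEQ_iff)
  qed
  have lipb: "L-lipschitz_on X b"
  proof (rule lipschitz_onI[OF _ L])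
    fix x y assume xy: "x \<in> X" "y \<in> X"
    have "(\<lambda>n. dist (a n x) (a n y)) \<longlonglongrightarrow> dist (b x) (b y)"
      using lim xy by (intro tendsto_dist)
    then show "dist (b x) (b y) \<le> L * dist x y"
      by (rule LIMSEQ_le_const2) (use lipschitz_onD[OF lip xy] in blast)
  qed
  have "delta X (a n) b \<le> e"
    if N: "\<forall>m\<ge>N. \<forall>n\<ge>N. delta X (a m) (a n) \<le> e" and n: "N \<le> n" for N e n
  proof (rule field_le_epsilon)
    fix e' :: real assume e': "0 < e'"
    \<comment> \<open>Chosen so that the bound of \<open>delta_le_of_abs_diff_le\<close> becomes
      exactly \<open>e'\<close>.\<close>
    define d where "d = e' / (1 + measure lebesgue X)"
    have mpos: "0 < 1 + measure lebesgue X" by (simp add: add_pos_nonneg)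
    have "0 < d" using e' mpos by (simp add: d_def)
    then obtain N' where N': "\<And>m n x. N' \<le> m \<Longrightarrow> N' \<le> n \<Longrightarrow> x \<in> X \<Longrightarrow> \<bar>a m x - a n x\<bar> < d"
      using unif by blast
    define m where "m = max N N'"
    have "\<bar>a m x - b x\<bar> \<le> d" if "x \<in> X" for x
    proof (rule LIMSEQ_le_const2)
      show "(\<lambda>n. \<bar>a m x - a n x\<bar>) \<longlonglongrightarrow> \<bar>a m x - b x\<bar>"
        by (intro tendsto_intros lim that)
      show "\<exists>N. \<forall>n\<ge>N. \<bar>a m x - a n x\<bar> \<le> d"
        using N'[of m _ x] that by (intro exI[of _ N']) (auto simp: m_def less_imp_le)
    qed
    then have "delta X (a m) b \<le> (1 + measure lebesgue X) * d"
      by (rule delta_le_of_abs_diff_le[OF X_nonempty op bdd lip lipb])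
    also have "\<dots> = e'" using mpos by (simp add: d_def)
    finally show "delta X (a n) b \<le> e + e'"
      using delta_triangle[OF X_nonempty op bdd lip lip lipb, of n m] N[rule_format, of n m] n
      by (simp add: m_def)
  qed
  then show ?thesis using lim lipb by blast
qed

text \<open>If \<open>u x < \<phi> x\<close>, some \<open>F n\<close> dips below \<open>\<phi>\<close> at a continuity point \<open>c\<close>, hence so does
  \<open>upper_env X j (F n)\<close> for large \<open>j\<close>. As \<open>v j\<close> is close in graph uniformly in \<open>j\<close>, it drops below
  \<open>\<phi>\<close> on an open set near \<open>c\<close>, and there \<open>f \<le> v j < \<phi>\<close>.\<close>

lemma lipschitz_le_limit_lower_env:
  assumes F: "\<And>n. F n \<in> Cae X"
    and u: "\<And>x. x \<in> X \<Longrightarrow> (\<lambda>n. lower_env X k (F n) x) \<longlonglongrightarrow> u x"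
    and cont: "\<And>j. 1 \<le> j \<Longrightarrow> continuous_on X (v j)"
    and close: "\<And>e. 0 < e \<Longrightarrow> \<exists>N. \<forall>n\<ge>N. \<forall>j\<ge>1. \<forall>x\<in>X. \<exists>y\<in>X.
      dist x y < e \<and> \<bar>upper_env X j (F n) x - v j y\<bar> < e"
    and fv: "\<And>j x. 1 \<le> j \<Longrightarrow> x \<in> X \<Longrightarrow> f x \<le> v j x"
    and \<phi>: "(real k)-lipschitz_on X \<phi>" "ae_le X \<phi> f" and x: "x \<in> X"
  shows "\<phi> x \<le> u x"
proof (rule ccontr)
  assume "\<not> ?thesis"
  then have less: "u x < \<phi> x" by simp
  define h where "h = (\<phi> x - u x) / 2"
  \<comment> \<open>Going from \<open>c\<close> to \<open>z\<close> below costs \<open>e\<close> in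
    the value and at most \<open>real k * e\<close> by the Lipschitz bound of \<open>\<phi>\<close>;
    the remaining \<open>e\<close> keeps the inequality strict.\<close>
  define e where "e = h / (2 + real k)"
  have h: "0 < h" using less by (simp add: h_def)
  then have e: "0 < e" "(2 + real k) * e = h" by (simp_all add: e_def)
  obtain N where N: "\<And>n j x. N \<le> n \<Longrightarrow> 1 \<le> j \<Longrightarrow> x \<in> X \<Longrightarrow>
      \<exists>y\<in>X. dist x y < e \<and> \<bar>upper_env X j (F n) x - v j y\<bar> < e"
    using close[OF e(1)] by blast
  have "\<forall>\<^sub>F n in sequentially. lower_env X k (F n) x < \<phi> x - h"
    using order_tendstoD(2)[OF u[OF x], of "\<phi> x - h"] h by (simp add: h_def field_simps)
  then obtain n where n: "N \<le> n" "lower_env X k (F n) x < \<phi> x - h"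
    using eventually_conj[OF _ eventually_ge_at_top[of N]]
    by (metis (no_types, lifting) eventually_happens sequentially_bot)
  let ?C = "cpts X (F n)"
  obtain M where M: "\<And>x. x \<in> X \<Longrightarrow> \<bar>F n x\<bar> \<le> M" using Cae_bound[OF F] by metis
  interpret dense_fun ?C "F n" M X using dense_fun_Cae op X_nonempty F M by blast
  obtain c where c: "c \<in> ?C" "F n c + real k * dist x c < \<phi> x - h"
    using lenv_lessD n(2) lower_env_eq_lenv[OF op X_nonempty F x] by metis
  have cX: "c \<in> X" using c(1) by (simp add: cpts_def)
  have lipD: "\<phi> x' \<le> \<phi> y + real k * dist x' y" if "x' \<in> X" "y \<in> X" for x' y
    using lipschitz_onD[OF \<phi>(1) that] by (simp add: dist_real_def)
  have "F n c < \<phi> c - h" using c(2) lipD[OF x cX] by linarith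
  then have "\<forall>\<^sub>F j in sequentially. upper_env X j (F n) c < \<phi> c - h"
    using order_tendstoD(2)[OF upper_env_tendsto[OF F c(1)]] by blast
  then obtain j where j: "1 \<le> j" "upper_env X j (F n) c < \<phi> c - h"
    using eventually_conj[OF _ eventually_ge_at_top[of 1]]
    by (metis (no_types, lifting) eventually_happens sequentially_bot)
  obtain z where z: "z \<in> X" "dist c z < e" "\<bar>upper_env X j (F n) c - v j z\<bar> < e"
    using N[OF n(1) j(1) cX] by blast
  have "real k * dist c z \<le> real k * e" using z(2) by (intro mult_left_mono) auto
  then have "v j z < \<phi> z"
    using z(3) j(2) lipD[OF cX z(1)] e by (simp add: algebra_simps abs_less_iff)
  moreover have "open {y \<in> X. 0 < \<phi> y - v j y}"
  proof -
    have "continuous_on X (\<lambda>y. \<phi> y - v j y)"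
      using cont[OF j(1)] lipschitz_on_continuous_on[OF \<phi>(1)] by (intro continuous_intros)
    from continuous_open_preimage[OF this op, of "{0<..}"] show ?thesis
      by (simp add: vimage_def Int_def)
  qed
  ultimately have "\<exists>y\<in>{y \<in> X. 0 < \<phi> y - v j y}. y \<in> X \<longrightarrow> \<phi> y \<le> f y"
    using \<phi>(2) z(1) by (intro AE_imp_dense) (auto simp: ae_le_def)
  then show False using fv[OF j(1)] by fastforce
qed

lemma lower_env_eqI:
  assumes "(real k)-lipschitz_on X u" "ae_le X u f" "x \<in> X"
    and "\<And>\<phi>. (real k)-lipschitz_on X \<phi> \<Longrightarrow> ae_le X \<phi> f \<Longrightarrow> \<phi> x \<le> u x"
  shows "lower_env X k f x = u x"
  unfolding lower_env_def by (rule cSup_eq_maximum) (use assms in auto)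

lemma abs_lipschitz_on_bound:
  fixes \<phi> :: "'a \<Rightarrow> real"
  assumes "L-lipschitz_on X \<phi>"
  obtains B where "\<And>x. x \<in> X \<Longrightarrow> \<bar>\<phi> x\<bar> \<le> B"
  using lipschitz_on_bounded_image[OF bdd assms] by (auto simp: bounded_iff)

text \<open>Serves twice: for a single member of the Cauchy sequence, and for the choice of the
  slope \<open>j\<close> in the density proof.\<close>

lemma integral_upper_minus_lower_tendsto_0:
  assumes f: "f \<in> Cae X"
  shows "(\<lambda>k. integral X (\<lambda>x. upper_env X k f x - lower_env X k f x)) \<longlonglongrightarrow> 0"
proof (subst decreasing_integral_tendsto_0_iff[OF op bdd])
  let ?w = "\<lambda>k x. upper_env X k f x - lower_env X k f x"
  show "continuous_on X (?w k)" for k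
    using lipschitz_lower[OF f] lipschitz_upper[OF f] lipschitz_on_continuous_on
    by (intro continuous_intros) blast+
  show "0 \<le> ?w k x" if "x \<in> X" for k x using lower_le_upper[OF f that] by simp
  show "?w (Suc k) x \<le> ?w k x" if "x \<in> X" for k x
    using upper_env_antimono[OF f that, of k "Suc k"] lower_env_mono[OF f that, of k "Suc k"] by simp
  show "bounded (?w 0 ` X)"
    using lipschitz_on_bounded_image[OF bdd lipschitz_on_diff[OF lipschitz_upper[OF f] lipschitz_lower[OF f]]]
    by blast
  show "AE x in lebesgue. x \<in> X \<longrightarrow> (\<lambda>k. ?w k x) \<longlonglongrightarrow> 0"
    using AE_cpts[OF f]
  proof eventually_elim
    case (elim x)
    show ?case
      using tendsto_diff[OF upper_env_tendsto[OF f] lower_env_tendsto[OF f], of x x] elim by auto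
  qed
qed

lemma r_metric_complete:
  assumes F: "\<And>n. F n \<in> Cae X"
    and Cauchy: "\<And>e. 0 < e \<Longrightarrow> \<exists>N. \<forall>m\<ge>N. \<forall>n\<ge>N. r_metric X (F m) (F n) < ereal e"
  shows "\<exists>f\<in>Cae X. (\<lambda>n. r_metric X (F n) f) \<longlonglongrightarrow> 0"
proof -
  have delta: "delta X (lower_env X k (F m)) (lower_env X k (F n)) < e"
    "delta X (upper_env X k (F m)) (upper_env X k (F n)) < e"
    if "1 \<le> k" "r_metric X (F m) (F n) < ereal e" for k m n e
    using delta_le_r_metric[OF that(1), of X "F m" "F n"] that(2)
    by (meson ereal_less(2) less_ereal.simps(1) order_le_less_trans)+
  \<comment> \<open>Bundles the conclusion of \<open>delta_Cauchy_limit\<close>, so that one choice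
    over \<open>k\<close> provides the limit with all its properties.\<close>
  define Q where "Q E k b \<longleftrightarrow> (real k)-lipschitz_on X b \<and> (\<forall>x\<in>X. (\<lambda>n. E n x) \<longlonglongrightarrow> b x) \<and>
    (\<forall>N e. (\<forall>m\<ge>N. \<forall>n\<ge>N. delta X (E m) (E n) \<le> e) \<longrightarrow> (\<forall>n\<ge>N. delta X (E n) b \<le> e))"
    for E :: "nat \<Rightarrow> 'a \<Rightarrow> real" and k :: nat and b
  have "\<exists>b. Q (\<lambda>n. lower_env X k (F n)) k b" if "1 \<le> k" for k
    unfolding Q_def
    by (rule delta_Cauchy_limit[OF lipschitz_lower[OF F]]) (meson Cauchy delta(1) that)
  then obtain u where u: "\<And>k. 1 \<le> k \<Longrightarrow> Q (\<lambda>n. lower_env X k (F n)) k (u k)" by metis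
  have "\<exists>b. Q (\<lambda>n. upper_env X k (F n)) k b" if "1 \<le> k" for k
    unfolding Q_def
    by (rule delta_Cauchy_limit[OF lipschitz_upper[OF F]]) (meson Cauchy delta(2) that)
  then obtain v where v: "\<And>k. 1 \<le> k \<Longrightarrow> Q (\<lambda>n. upper_env X k (F n)) k (v k)" by metis
  have u_lip: "(real k)-lipschitz_on X (u k)" and v_lip: "(real k)-lipschitz_on X (v k)"
    if "1 \<le> k" for k
    using u[OF that] v[OF that] by (simp_all add: Q_def)
  have u_lim: "(\<lambda>n. lower_env X k (F n) x) \<longlonglongrightarrow> u k x"
    and v_lim: "(\<lambda>n. upper_env X k (F n) x) \<longlonglongrightarrow> v k x" if "1 \<le> k" "x \<in> X" for k x
    using u[OF that(1)] v[OF that(1)] that(2) by (simp_all add: Q_def)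
  have u_cont: "continuous_on X (u k)" and v_cont: "continuous_on X (v k)" if "1 \<le> k" for k
    using u_lip[OF that] v_lip[OF that] lipschitz_on_continuous_on by blast+
  have u_mono: "u k x \<le> u k' x" if "1 \<le> k" "k \<le> k'" "x \<in> X" for k k' x
    using that by (intro LIMSEQ_le[OF u_lim u_lim] exI[of _ 0]) (auto intro: lower_env_mono F)
  have v_mono: "v k' x \<le> v k x" if "1 \<le> k" "k \<le> k'" "x \<in> X" for k k' x
    using that by (intro LIMSEQ_le[OF v_lim v_lim] exI[of _ 0]) (auto intro: upper_env_antimono F)
  have u_le_v: "u k x \<le> v k' x" if "1 \<le> k" "1 \<le> k'" "x \<in> X" for k k' x
    using that by (intro LIMSEQ_le[OF u_lim v_lim] exI[of _ 0]) (auto intro: lower_le_upper F)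
  \<comment> \<open>\<open>r_metric\<close> bounds the distances at all slopes simultaneously, so
    \<open>N\<close> does not depend on \<open>k\<close>.\<close>
  have uniform: "\<exists>N. \<forall>n\<ge>N. \<forall>k\<ge>1. delta X (lower_env X k (F n)) (u k) \<le> e
      \<and> delta X (upper_env X k (F n)) (v k) \<le> e" if e: "0 < e" for e
  proof -
    obtain N where N: "\<And>m n. N \<le> m \<Longrightarrow> N \<le> n \<Longrightarrow> r_metric X (F m) (F n) < ereal e"
      using Cauchy[OF e] by blast
    have "delta X (lower_env X k (F n)) (u k) \<le> e" "delta X (upper_env X k (F n)) (v k) \<le> e"
      if n: "N \<le> n" and k: "1 \<le> k" for n k
    proof -
      have "\<forall>m\<ge>N. \<forall>n\<ge>N. delta X (lower_env X k (F m)) (lower_env X k (F n)) \<le> e"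
        "\<forall>m\<ge>N. \<forall>n\<ge>N. delta X (upper_env X k (F m)) (upper_env X k (F n)) \<le> e"
        using delta[OF k N] by (simp_all add: less_imp_le)
      then show "delta X (lower_env X k (F n)) (u k) \<le> e" "delta X (upper_env X k (F n)) (v k) \<le> e"
        using u[OF k] v[OF k] n unfolding Q_def by blast+
    qed
    then show ?thesis by blast
  qed
  have close: "\<exists>N. \<forall>n\<ge>N. \<forall>j\<ge>1. \<forall>x\<in>X. \<exists>y\<in>X. dist x y < e \<and> \<bar>upper_env X j (F n) x - v j y\<bar> < e"
    "\<exists>N. \<forall>n\<ge>N. \<forall>j\<ge>1. \<forall>x\<in>X. \<exists>y\<in>X. dist x y < e \<and> \<bar>lower_env X j (F n) x - u j y\<bar> < e"
    if e: "0 < e" for e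
  proof -
    obtain N where N: "\<And>n k. N \<le> n \<Longrightarrow> 1 \<le> k \<Longrightarrow> delta X (lower_env X k (F n)) (u k) \<le> e / 2"
      "\<And>n k. N \<le> n \<Longrightarrow> 1 \<le> k \<Longrightarrow> delta X (upper_env X k (F n)) (v k) \<le> e / 2"
      using uniform[of "e / 2"] e by auto
    have "hgraph X (lower_env X k (F n)) (u k) < e" "hgraph X (upper_env X k (F n)) (v k) < e"
      if "N \<le> n" "1 \<le> k" for n k
      using N[OF that] e delta_bounds(4)[OF X_nonempty op bdd lipschitz_lower[OF F] u_lip[OF that(2)], of k n]
        delta_bounds(4)[OF X_nonempty op bdd lipschitz_upper[OF F] v_lip[OF that(2)], of k n] by linarith+
    then show "\<exists>N. \<forall>n\<ge>N. \<forall>j\<ge>1. \<forall>x\<in>X. \<exists>y\<in>X. dist x y < e \<and> \<bar>upper_env X j (F n) x - v j y\<bar> < e"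
      "\<exists>N. \<forall>n\<ge>N. \<forall>j\<ge>1. \<forall>x\<in>X. \<exists>y\<in>X. dist x y < e \<and> \<bar>lower_env X j (F n) x - u j y\<bar> < e"
      using hgraph_lessD[OF bdd lipschitz_on_bounded_image[OF bdd lipschitz_lower[OF F]]]
        hgraph_lessD[OF bdd lipschitz_on_bounded_image[OF bdd lipschitz_upper[OF F]]]
      by meson+
  qed
  \<comment> \<open>Any function between all \<open>u k\<close> and all \<open>v k\<close> would
    serve; the next step shows that almost everywhere only one value is possible.\<close>
  define f where "f x = (SUP k\<in>{1..}. u k x)" for x
  have bddu: "bdd_above ((\<lambda>k. u k x) ` {1..})" if "x \<in> X" for x
    using u_le_v[of _ 1 x] that by (intro bdd_aboveI2[of _ _ "v 1 x"]) auto
  have uf: "u k x \<le> f x" if "1 \<le> k" "x \<in> X" for k x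
    unfolding f_def using that bddu by (intro cSUP_upper) auto
  have fv: "f x \<le> v k x" if "1 \<le> k" "x \<in> X" for k x
    unfolding f_def using u_le_v that by (intro cSUP_least) auto
  \<comment> \<open>The shift to \<open>Suc k\<close> is due to \<open>u\<close> and
    \<open>v\<close> being specified for \<open>k \<ge> 1\<close> only.\<close>
  have "AE x in lebesgue. x \<in> X \<longrightarrow> (\<lambda>k. v (Suc k) x - u (Suc k) x) \<longlonglongrightarrow> 0"
  proof (subst decreasing_integral_tendsto_0_iff[symmetric, OF op bdd])
    let ?w = "\<lambda>k x. v (Suc k) x - u (Suc k) x"
    show "continuous_on X (?w k)" for k by (intro continuous_intros u_cont v_cont) auto
    show nn: "0 \<le> ?w k x" if "x \<in> X" for k x using u_le_v that by simp
    show "?w (Suc k) x \<le> ?w k x" if "x \<in> X" for k x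
      using u_mono[of "Suc k" "Suc (Suc k)" x] v_mono[of "Suc k" "Suc (Suc k)" x] that by simp
    show "bounded (?w 0 ` X)"
      using lipschitz_on_bounded_image[OF bdd lipschitz_on_diff[OF v_lip u_lip, of "Suc 0" "Suc 0"]] by simp
    have wint: "?w k integrable_on X" for k
      using integrable_abs_diff[OF op bdd v_lip u_lip, of "Suc k" "Suc k"] nn
      by (simp cong: Henstock_Kurzweil_Integration.integrable_cong)
    show "(\<lambda>k. integral X (?w k)) \<longlonglongrightarrow> 0"
    proof (rule LIMSEQ_I)
      fix e :: real assume e: "0 < e"
      \<comment> \<open>The order is essential: \<open>n\<close> is fixed first, with an error
        uniform in \<open>k\<close>, and only then is \<open>K\<close> chosen for this one
        \<open>F n\<close>.\<close>
      obtain n where n: "\<And>k. 1 \<le> k \<Longrightarrow> delta X (lower_env X k (F n)) (u k) \<le> e / 4"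
        "\<And>k. 1 \<le> k \<Longrightarrow> delta X (upper_env X k (F n)) (v k) \<le> e / 4"
        using uniform[of "e / 4"] e by fastforce
      let ?D = "\<lambda>k x. upper_env X k (F n) x - lower_env X k (F n) x"
      obtain K where K: "\<And>k. K \<le> k \<Longrightarrow> \<bar>integral X (?D k)\<bar> < e / 4"
        using LIMSEQ_D[OF integral_upper_minus_lower_tendsto_0[OF F], of "e / 4" n] e by auto
      have "norm (integral X (?w k) - 0) < e" if k: "K \<le> k" for k
      proof -
        let ?l = "\<lambda>x. \<bar>lower_env X (Suc k) (F n) x - u (Suc k) x\<bar>"
        let ?r = "\<lambda>x. \<bar>upper_env X (Suc k) (F n) x - v (Suc k) x\<bar>"
        have il: "?l integrable_on X" "?r integrable_on X"
          using integrable_abs_diff[OF op bdd] lipschitz_lower[OF F] lipschitz_upper[OF F] u_lip v_lip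
          by (metis le_add1 plus_1_eq_Suc)+
        have iD: "?D (Suc k) integrable_on X"
          using integrable_abs_diff[OF op bdd lipschitz_upper[OF F] lipschitz_lower[OF F], of "Suc k" n "Suc k" n]
            lower_le_upper[OF F]
          by (simp cong: Henstock_Kurzweil_Integration.integrable_cong)
        have "integral X (?w k) \<le> integral X (\<lambda>x. ?r x + ?D (Suc k) x + ?l x)"
          by (rule integral_le[OF wint]) (use il iD in \<open>auto intro!: integrable_add\<close>)
        also have "\<dots> = integral X ?r + integral X (?D (Suc k)) + integral X ?l"
          using il iD by (simp add: Henstock_Kurzweil_Integration.integral_add integrable_add)
        also have "\<dots> < e / 4 + e / 4 + e / 4 + e / 4"
          using n[of "Suc k"] K[of "Suc k"] k e
            delta_bounds(3)[OF X_nonempty op bdd lipschitz_lower[OF F] u_lip, of "Suc k" "Suc k" n]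
            delta_bounds(3)[OF X_nonempty op bdd lipschitz_upper[OF F] v_lip, of "Suc k" "Suc k" n]
          by (simp add: abs_less_iff)
        finally show ?thesis using integral_nonneg[OF wint[of k]] nn by simp
      qed
      then show "\<exists>K. \<forall>k\<ge>K. norm (integral X (?w k) - 0) < e" by blast
    qed
  qed
  \<comment> \<open>Near \<open>x\<close>, \<open>f\<close> is squeezed between two continuous
    functions whose values at \<open>x\<close> differ by less than \<open>e / 2\<close>.\<close>
  moreover have "continuous (at x within X) f"
    if x: "x \<in> X" and lim: "(\<lambda>k. v (Suc k) x - u (Suc k) x) \<longlonglongrightarrow> 0" for x
    unfolding continuous_within_eps_delta
  proof (intro allI impI)
    fix e :: real assume e: "0 < e"
    obtain k where k: "v (Suc k) x - u (Suc k) x < e / 2"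
      using order_tendstoD(2)[OF lim, of "e / 2"] e by (auto simp: eventually_sequentially)
    have c: "continuous (at x within X) (u (Suc k))" "continuous (at x within X) (v (Suc k))"
      using u_cont[of "Suc k"] v_cont[of "Suc k"] x by (auto simp: continuous_on_eq_continuous_within)
    obtain d1 where d1: "0 < d1" "\<And>y. y \<in> X \<Longrightarrow> dist y x < d1 \<Longrightarrow> dist (u (Suc k) y) (u (Suc k) x) < e / 2"
      using c(1) e unfolding continuous_within_eps_delta by (meson half_gt_zero)
    obtain d2 where d2: "0 < d2" "\<And>y. y \<in> X \<Longrightarrow> dist y x < d2 \<Longrightarrow> dist (v (Suc k) y) (v (Suc k) x) < e / 2"
      using c(2) e unfolding continuous_within_eps_delta by (meson half_gt_zero)
    have "dist (f y) (f x) < e" if "y \<in> X" "dist y x < min d1 d2" for y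
    proof -
      have "u (Suc k) x \<le> f x" "f x \<le> v (Suc k) x" "u (Suc k) y \<le> f y" "f y \<le> v (Suc k) y"
        using uf fv x that by simp_all
      moreover have "\<bar>u (Suc k) y - u (Suc k) x\<bar> < e / 2" "\<bar>v (Suc k) y - v (Suc k) x\<bar> < e / 2"
        using d1(2)[OF that(1)] d2(2)[OF that(1)] that(2) by (simp_all add: dist_real_def)
      ultimately show ?thesis using k unfolding dist_real_def by linarith
    qed
    then show "\<exists>d>0. \<forall>x'\<in>X. dist x' x < d \<longrightarrow> dist (f x') (f x) < e"
      using d1(1) d2(1) by (intro exI[of _ "min d1 d2"]) auto
  qed
  ultimately have "AE x in lebesgue. x \<in> X \<longrightarrow> continuous (at x within X) f"
    by (auto elim: eventually_mono)
  moreover have "bounded (f ` X)"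
  proof -
    obtain A where A: "\<And>x. x \<in> X \<Longrightarrow> \<bar>u 1 x\<bar> \<le> A" using abs_lipschitz_on_bound u_lip[of 1] by blast
    obtain B where B: "\<And>x. x \<in> X \<Longrightarrow> \<bar>v 1 x\<bar> \<le> B" using abs_lipschitz_on_bound v_lip[of 1] by blast
    have "\<bar>f x\<bar> \<le> max A B" if "x \<in> X" for x
      using A[OF that] B[OF that] uf[of 1 x] fv[of 1 x] that by auto
    then show ?thesis by (auto simp: bounded_iff)
  qed
  ultimately have f: "f \<in> Cae X" by (simp add: Cae_def)
  have lower: "lower_env X k f x = u k x" if k: "1 \<le> k" and x: "x \<in> X" for k x
  proof (rule lower_env_eqI[OF u_lip[OF k] _ x])
    show "ae_le X (u k) f" using uf[OF k] by (simp add: ae_le_def)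
    show "\<phi> x \<le> u k x" if "(real k)-lipschitz_on X \<phi>" "ae_le X \<phi> f" for \<phi>
      by (rule lipschitz_le_limit_lower_env[OF F u_lim[OF k] v_cont close(1) fv that x])
  qed
  have upper: "upper_env X k f x = v k x" if k: "1 \<le> k" and x: "x \<in> X" for k x
  proof -
    have "lower_env X k (\<lambda>x. - f x) x = - v k x"
    proof (rule lower_env_eqI[OF lipschitz_on_minus[OF v_lip[OF k]] _ x])
      show "ae_le X (\<lambda>x. - v k x) (\<lambda>x. - f x)" using fv[OF k] by (simp add: ae_le_def)
      show "\<phi> x \<le> - v k x" if "(real k)-lipschitz_on X \<phi>" "ae_le X \<phi> (\<lambda>x. - f x)" for \<phi>
      \<comment> \<open>Negation exchanges the roles: \<open>- v k\<close> is the limit of lower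
        envelopes, and the \<open>- u j\<close> are limits of upper ones.\<close>
      proof (rule lipschitz_le_limit_lower_env[OF Cae_uminus[OF F] _ _ _ _ that x])
        show "(\<lambda>n. lower_env X k (\<lambda>x. - F n x) x) \<longlonglongrightarrow> - v k x" if "x \<in> X" for x
          using tendsto_minus[OF v_lim[OF k that]] by (simp add: upper_env_eq_lower_env)
        show "continuous_on X (\<lambda>x. - u j x)" if "1 \<le> j" for j
          using u_cont[OF that] by (rule continuous_on_minus)
        show "- f x \<le> - u j x" if "1 \<le> j" "x \<in> X" for j x using uf[OF that] by simp
        show "\<exists>N. \<forall>n\<ge>N. \<forall>j\<ge>1. \<forall>x\<in>X. \<exists>y\<in>X. dist x y < e \<and>
          \<bar>upper_env X j (\<lambda>x. - F n x) x - - u j y\<bar> < e" if "0 < e" for e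
          using close(2)[OF that] by (simp add: upper_env_eq_lower_env abs_minus_commute)
      qed
    qed
    then show ?thesis by (simp add: upper_env_eq_lower_env)
  qed
  have r_le: "\<exists>N. \<forall>n\<ge>N. r_metric X (F n) f \<le> ereal e" if "0 < e" for e
  proof -
    obtain N where N: "\<forall>n\<ge>N. \<forall>k\<ge>1. delta X (lower_env X k (F n)) (u k) \<le> e
      \<and> delta X (upper_env X k (F n)) (v k) \<le> e" using uniform[OF \<open>0 < e\<close>] by blast
    have "r_metric X (F n) f \<le> ereal e" if "N \<le> n" for n
      unfolding r_metric_le_iff
    proof (intro allI impI conjI)
      fix k :: nat assume k: "1 \<le> k"
      show "delta X (lower_env X k (F n)) (lower_env X k f) \<le> e"
        using N that k delta_cong[of X "lower_env X k (F n)" "lower_env X k (F n)" "lower_env X k f" "u k"]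
          lower[OF k] by simp
      show "delta X (upper_env X k (F n)) (upper_env X k f) \<le> e"
        using N that k delta_cong[of X "upper_env X k (F n)" "upper_env X k (F n)" "upper_env X k f" "v k"]
          upper[OF k] by simp
    qed
    then show ?thesis by blast
  qed
  have r0: "0 \<le> r_metric X (F n) f" for n
    using delta_le_r_metric(1)[of 1 X "F n" f]
      delta_bounds(5)[OF X_nonempty op bdd lipschitz_lower[OF F] lipschitz_lower[OF f], of 1 n 1]
    by (metis ereal_less_eq(5) order.refl order_trans)
  have "(\<lambda>n. r_metric X (F n) f) \<longlonglongrightarrow> 0"
  proof (rule order_tendstoI)
    show "\<forall>\<^sub>F n in sequentially. a < r_metric X (F n) f" if "a < 0" for a
      using that r0 by (intro always_eventually) (meson order_less_le_trans)
    show "\<forall>\<^sub>F n in sequentially. r_metric X (F n) f < a" if a: "0 < a" for a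
    proof -
      obtain e where "0 < ereal e" "ereal e < a" using ereal_dense2[OF a] by (auto simp: zero_ereal_def)
      then show ?thesis using r_le[of e] unfolding eventually_sequentially
        by (meson ereal_less(2) order_le_less_trans)
    qed
  qed
  then show ?thesis using f by blast
qed

end

section \<open>Density of continuous functions\<close>

context domain
begin

definition bdist :: "'a \<Rightarrow> real" where
  "bdist x = infdist x (- X)"

text \<open>For an empty complement \<open>infdist\<close>, and with it \<open>bdist\<close>, would
  take the default value 0.\<close>

lemma compl_nonempty: "- X \<noteq> {}"
proof
  assume "- X = {}"
  then have "X = UNIV" by auto
  then show False using bdd not_bounded_UNIV by metis
qed

lemma bdist_pos: "x \<in> X \<Longrightarrow> 0 < bdist x"
  unfolding bdist_def using op compl_nonempty by (intro infdist_pos_not_in_closed) auto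

lemma bdist_le: "bdist x \<le> bdist y + dist x y"
  unfolding bdist_def by (rule infdist_triangle)

lemma in_X_of_dist: "dist x y < bdist x \<Longrightarrow> y \<in> X"
  using infdist_le[of y "- X" x] unfolding bdist_def by force

lemma compact_uniform_bound:
  fixes R :: "'a \<Rightarrow> nat \<Rightarrow> bool"
  assumes mono: "\<And>x m n. R x m \<Longrightarrow> m \<le> n \<Longrightarrow> R x n"
    and loc: "\<And>p. p \<in> X \<Longrightarrow> \<exists>r>0. \<exists>n. \<forall>x\<in>X. dist p x < r \<longrightarrow> R x n"
    and K: "compact K" "K \<subseteq> X"
  shows "\<exists>n. \<forall>x\<in>K. R x n"
proof -
  obtain r N where rN: "\<And>p. p \<in> X \<Longrightarrow> 0 < r p"
    "\<And>p x. p \<in> X \<Longrightarrow> x \<in> X \<Longrightarrow> dist p x < r p \<Longrightarrow> R x (N p)"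
    using loc by metis
  have "K \<subseteq> (\<Union>p\<in>K. ball p (r p))" using rN(1) K(2) by force
  then obtain D where D: "D \<subseteq> K" "finite D" "K \<subseteq> (\<Union>p\<in>D. ball p (r p))"
    using compactE_image[OF K(1), of K "\<lambda>p. ball p (r p)"] by auto
  \<comment> \<open>The sum is a common upper bound of the finitely many \<open>N p\<close>.\<close>
  have "R x (sum N D)" if "x \<in> K" for x
  proof -
    have "x \<in> (\<Union>p\<in>D. ball p (r p))" using that D(3) by blast
    then obtain p where p: "p \<in> D" "dist p x < r p" by auto
    have "R x (N p)" using rN(2)[of p x] p D(1) K(2) that by blast
    then show ?thesis using mono member_le_sum[OF p(1), of N] D(2) by blast
  qed
  then show ?thesis by blast
qed

text \<open>A locally bounded requirement is dominated by \<open>1 / \<tau>\<close>, where the largest admissible radius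
  \<open>\<tau>\<close> is a 1-Lipschitz function; the domination even holds at a distance comparable to the
  distance to the boundary.\<close>

lemma continuous_domination:
  fixes R :: "'a \<Rightarrow> nat \<Rightarrow> bool"
  assumes mono: "\<And>x m n. R x m \<Longrightarrow> m \<le> n \<Longrightarrow> R x n"
    and loc: "\<And>p. p \<in> X \<Longrightarrow> \<exists>r>0. \<exists>n. \<forall>x\<in>X. dist p x < r \<longrightarrow> R x n"
  obtains L :: "'a \<Rightarrow> nat" and w :: "'a \<Rightarrow> real"
  where "\<And>x. x \<in> X \<Longrightarrow> R x (L x)" "continuous_on X w" "\<And>y. y \<in> X \<Longrightarrow> 0 < w y"
    "\<And>x y. x \<in> X \<Longrightarrow> y \<in> X \<Longrightarrow> dist x y \<le> bdist y / 2 \<Longrightarrow> real (L x) \<le> w y"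
proof
  define L where "L x = (LEAST n. R x n)" for x
  \<comment> \<open>The slack \<open>2 * r\<close> makes the supremum 1-Lipschitz: moving
    \<open>y\<close> by \<open>d\<close> shifts the ball by \<open>d\<close> and changes
    \<open>bdist y / 2\<close> by at most \<open>d / 2\<close>, together less than the
    \<open>2 * d\<close> gained by lowering \<open>r\<close> by \<open>d\<close>, if
    \<open>d > 0\<close>.\<close>
  define T where "T y = {r. 0 < r \<and> r \<le> 1 \<and>
    (\<forall>x\<in>X. dist x y \<le> bdist y / 2 + 2 * r \<longrightarrow> real (L x) \<le> 1 / r)}" for y
  \<comment> \<open>Halving puts \<open>\<tau> y\<close> strictly below the supremum, so some
    admissible radius exceeds it whether or not the supremum is attained.\<close>
  define \<tau> where "\<tau> y = Sup (T y) / 2" for y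
  show "R x (L x)" if x: "x \<in> X" for x
  proof -
    obtain n where "R x n" using loc[OF x] x by force
    then show ?thesis unfolding L_def by (rule LeastI)
  qed
  have bddT: "bdd_above (T y)" for y by (rule bdd_aboveI[of _ 1]) (simp add: T_def)
  have neT: "T y \<noteq> {}" if y: "y \<in> X" for y
  proof -
    have b: "0 < bdist y" using bdist_pos[OF y] .
    \<comment> \<open>The factor is \<open>1 / 2 + 2 / 8\<close>, in view of
      \<open>r \<le> bdist y / 8\<close> below; the closed ball is compact and still inside
      \<open>X\<close>.\<close>
    have "cball y (3 / 4 * bdist y) \<subseteq> X" using in_X_of_dist[of y] b by auto
    have "\<exists>n. \<forall>x\<in>cball y (3 / 4 * bdist y). R x n"
    proof (rule compact_uniform_bound[of R])
      show "R x n" if "R x m" "m \<le> n" for x m n using mono that by blast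
      show "\<exists>r>0. \<exists>n. \<forall>x\<in>X. dist p x < r \<longrightarrow> R x n" if "p \<in> X" for p using loc[OF that] .
    qed (use \<open>cball y (3 / 4 * bdist y) \<subseteq> X\<close> in auto)
    then obtain n where n: "\<And>x. dist y x \<le> 3 / 4 * bdist y \<Longrightarrow> R x n"
      unfolding mem_cball Ball_def by blast
    define r where "r = min (bdist y / 8) (1 / (real n + 1))"
    have r: "0 < r" "r \<le> bdist y / 8" "r \<le> 1 / (real n + 1)" using b by (auto simp: r_def)
    have "real (L x) \<le> 1 / r" if "dist x y \<le> bdist y / 2 + 2 * r" for x
    proof -
      have "R x n" using n[of x] that r(2) by (simp add: dist_commute)
      then have "L x \<le> n" unfolding L_def by (rule Least_le)
      moreover have "real n + 1 \<le> 1 / r" using r(1,3) by (simp add: field_simps)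
      ultimately show ?thesis by simp
    qed
    moreover have "r \<le> 1" using r(3) by (rule order_trans) simp
    ultimately show ?thesis using r(1) unfolding T_def by blast
  qed
  have pos: "0 < \<tau> y" if y: "y \<in> X" for y
  proof -
    obtain r where r: "r \<in> T y" using neT[OF y] by auto
    then have "r \<le> Sup (T y)" using bddT by (rule cSup_upper)
    then show ?thesis using r by (simp add: \<tau>_def T_def)
  qed
  have lip: "Sup (T y) \<le> Sup (T y') + dist y y'" if y: "y \<in> X" "y' \<in> X" for y y'
  proof (rule cSup_least[OF neT[OF y(1)]])
    fix r assume r: "r \<in> T y"
    show "r \<le> Sup (T y') + dist y y'"
    proof (cases "r \<le> dist y y'")
      case True
      then show ?thesis using pos[OF y(2)] by (simp add: \<tau>_def)
    next
      case False
      have "real (L x) \<le> 1 / (r - dist y y')"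
        if x: "x \<in> X" "dist x y' \<le> bdist y' / 2 + 2 * (r - dist y y')" for x
      proof -
        have "dist x y \<le> bdist y / 2 + 2 * r"
          using x(2) dist_triangle[of x y y'] bdist_le[of y' y] zero_le_dist[of y y']
          unfolding dist_commute[of y' y] by argo
        then have "real (L x) \<le> 1 / r" using r x(1) by (simp add: T_def)
        also have "\<dots> \<le> 1 / (r - dist y y')" using False zero_le_dist[of y y']
          by (intro divide_left_mono mult_pos_pos) linarith+
        finally show ?thesis .
      qed
      moreover have "r \<le> 1" using r by (simp add: T_def)
      moreover from this have "r - dist y y' \<le> 1" using zero_le_dist[of y y'] by linarith
      ultimately have "r - dist y y' \<in> T y'" using False by (simp add: T_def)
      then have "r - dist y y' \<le> Sup (T y')" using bddT by (rule cSup_upper)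
      then show ?thesis by simp
    qed
  qed
  have "1-lipschitz_on X \<tau>"
  proof (rule lipschitz_onI)
    show "dist (\<tau> x) (\<tau> y) \<le> 1 * dist x y" if "x \<in> X" "y \<in> X" for x y
      using lip[OF that] lip[OF that(2,1)] zero_le_dist[of x y]
      unfolding \<tau>_def dist_real_def dist_commute[of y x] by linarith
  qed simp
  then show "continuous_on X (\<lambda>y. 1 / \<tau> y)"
    using pos by (intro continuous_intros lipschitz_on_continuous_on) force+
  show "0 < 1 / \<tau> y" if "y \<in> X" for y using pos[OF that] by simp
  show "real (L x) \<le> 1 / \<tau> y" if xy: "x \<in> X" "y \<in> X" "dist x y \<le> bdist y / 2" for x y
  proof -
    have "\<tau> y < Sup (T y)" using pos[OF xy(2)] by (simp add: \<tau>_def)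
    then obtain r where r: "r \<in> T y" "\<tau> y < r" using less_cSupE neT[OF xy(2)] by metis
    have "real (L x) \<le> 1 / r" using r(1) xy by (simp add: T_def)
    also have "\<dots> \<le> 1 / \<tau> y" using r pos[OF xy(2)] by (intro divide_left_mono) auto
    finally show ?thesis .
  qed
qed

end

section \<open>Local thresholds for the slope\<close>

context bounded_fun
begin

lemma near_supremum:
  assumes "S \<subseteq> C" "S \<noteq> {}" "0 < e"
  shows "\<exists>c\<in>S. \<forall>c'\<in>S. f c' \<le> f c + e"
proof -
  have "bdd_above (f ` S)" using bound assms(1) by (intro bdd_aboveI2[of _ _ M]) (auto simp: abs_le_iff)
  moreover obtain c where "c \<in> S" "Sup (f ` S) - e < f c"
    using less_cSupE[of "Sup (f ` S) - e" "f ` S"] assms by auto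
  ultimately show ?thesis using cSUP_upper[of _ S f] by force
qed

text \<open>Each competitor changes by at most \<open>\<bar>k - k'\<bar> * D\<close>. On a bounded
  set the envelope is thus continuous in its slope, as required when the slope varies with the
  point.\<close>

lemma lenv_diff_slope:
  assumes "0 \<le> k" "0 \<le> k'" "\<And>c. c \<in> C \<Longrightarrow> dist x c \<le> D" "0 \<le> D"
  shows "\<bar>lenv C f k x - lenv C f k' x\<bar> \<le> \<bar>k - k'\<bar> * D"
proof -
  have *: "lenv C f a x \<le> lenv C f b x + \<bar>k - k'\<bar> * D"
    if ab: "0 \<le> a" "0 \<le> b" "\<bar>a - b\<bar> = \<bar>k - k'\<bar>" for a b
  proof -
    have "lenv C f a x - \<bar>k - k'\<bar> * D \<le> lenv C f b x"
    proof (rule lenv_ge)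
      fix c assume c: "c \<in> C"
      have "(a - b) * dist x c \<le> \<bar>a - b\<bar> * dist x c" by (intro mult_right_mono) auto
      also have "\<dots> \<le> \<bar>k - k'\<bar> * D" unfolding ab(3) using assms(3)[OF c] by (intro mult_left_mono) auto
      finally show "lenv C f a x - \<bar>k - k'\<bar> * D \<le> f c + b * dist x c"
        using lenv_le[OF ab(1) c, of x] by (simp add: algebra_simps)
    qed
    then show ?thesis by simp
  qed
  show ?thesis using *[of k k'] *[of k' k] assms(1,2) by (simp add: abs_le_iff abs_minus_commute)
qed

end

text \<open>\<open>j\<close> is the slope at which the gap between the envelopes of \<open>f\<close>
  will have a small integral; every threshold is forced to be at least \<open>j\<close>.\<close>

locale approximation = domain X + dense_fun C f M X
  for X C :: "'a::euclidean_space set" and f M +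
  fixes eps :: real and j :: nat
  assumes cont: "\<And>c. c \<in> C \<Longrightarrow> continuous (at c within X) f"
    and M: "1 \<le> M" and eps: "0 < eps" "eps \<le> 1"
begin

sublocale neg: dense_fun C "\<lambda>c. - f c" M X
  by (rule uminus)

lemma C_sub_X: "c \<in> C \<Longrightarrow> c \<in> X"
  using subset by auto

lemma lenv_approx:
  assumes "c \<in> C" "0 < e"
  shows "\<exists>n::nat. \<forall>k\<ge>real n. f c - e \<le> lenv C f k c"
  using eventually_lenv_ge[OF C_sub_X[OF assms(1)] cont[OF assms(1)] subset assms(2,1)] by blast

lemma uenv_approx:
  assumes "c \<in> C" "0 < e"
  shows "\<exists>n::nat. \<forall>k\<ge>real n. uenv C f k c \<le> f c + e"
proof -
  obtain n where n: "\<forall>k\<ge>real n. - f c - e \<le> lenv C (\<lambda>c. - f c) k c"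
    using neg.eventually_lenv_ge[OF C_sub_X[OF assms(1)] continuous_minus[OF cont[OF assms(1)]] subset assms(2,1)]
    by blast
  then show ?thesis by (intro exI[of _ n]) (force simp: uenv_def)
qed

text \<open>A radius that keeps points within \<open>eps\<close> and well inside \<open>X\<close>.
  The factor \<open>1 / 8\<close> also makes it vary slowly, so that nearby points have comparable
  radii.\<close>

definition rho :: "'a \<Rightarrow> real" where
  "rho x = min eps (bdist x) / 8"

lemma rho_pos: "x \<in> X \<Longrightarrow> 0 < rho x"
  using bdist_pos eps by (simp add: rho_def)

lemma rho_le: "rho x \<le> eps / 8" "rho x \<le> bdist x / 8"
  by (auto simp: rho_def)

lemma rho_triangle: "rho x \<le> rho y + dist x y / 8"
  using bdist_le[of x y] zero_le_dist[of x y] unfolding rho_def by linarith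

text \<open>\<open>good x n\<close>: beyond slope \<open>n\<close> all functions squeezed between the two envelopes
  have close graphs near \<open>x\<close>.\<close>

definition good :: "'a \<Rightarrow> nat \<Rightarrow> bool" where
  "good x n \<longleftrightarrow> 3 * M \<le> real n * rho x \<and> j \<le> n \<and>
    (\<forall>v t. continuous_on X v \<longrightarrow> lenv C f n x \<le> t \<longrightarrow> t \<le> uenv C f n x \<longrightarrow>
      (\<forall>y\<in>ball x (rho x). lenv C f n y \<le> v y \<and> v y \<le> uenv C f n y) \<longrightarrow>
      (\<exists>x'\<in>X. dist x x' \<le> eps \<and> \<bar>t - v x'\<bar> \<le> eps))"

text \<open>A larger slope narrows the interval between the envelopes, so whatever is squeezed at
  \<open>n\<close> is squeezed at \<open>m\<close>.\<close>

lemma good_mono: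
  assumes "good x m" "m \<le> n" "x \<in> X"
  shows "good x n"
proof -
  have "real m * rho x \<le> real n * rho x" using assms rho_pos[of x] by (intro mult_right_mono) auto
  moreover have "lenv C f m y \<le> lenv C f n y" "uenv C f n y \<le> uenv C f m y" for y
    using lenv_mono[of m n] uenv_antimono[of m n] assms(2) by auto
  ultimately show ?thesis using assms(1,2) unfolding good_def
    by (meson order_trans)
qed

text \<open>Near \<open>p\<close> the squeezed functions attain, up to \<open>eps\<close>, both the infimum and the supremum
  of \<open>f\<close> on a ball; the ball is connected, so they attain all values in between.\<close>

lemma good_locally:
  assumes p: "p \<in> X"
  shows "\<exists>r>0. \<exists>n. \<forall>x\<in>X. dist p x < r \<longrightarrow> good x n"
proof -
  let ?B = "ball p (rho p / 2)" and ?r = "rho p / 8"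
  have rp: "0 < rho p" using rho_pos[OF p] .
  have BX: "?B \<subseteq> X" using in_X_of_dist[of p] rho_le(2)[of p] bdist_pos[OF p] by force
  obtain c0 where "c0 \<in> C" "dist p c0 < rho p / 2" using near[OF p half_gt_zero[OF rp]] .
  then have ne: "C \<inter> ?B \<noteq> {}" by auto
  obtain c2 where c2: "c2 \<in> C \<inter> ?B" "\<And>c. c \<in> C \<inter> ?B \<Longrightarrow> f c \<le> f c2 + eps / 2"
    using near_supremum[OF Int_lower1 ne half_gt_zero[OF eps(1)]] by blast
  obtain c1 where c1: "c1 \<in> C \<inter> ?B" "\<And>c. c \<in> C \<inter> ?B \<Longrightarrow> - f c \<le> - f c1 + eps / 2"
    using neg.near_supremum[OF Int_lower1 ne half_gt_zero[OF eps(1)]] by blast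
  obtain n1 where n1: "\<And>k. real n1 \<le> k \<Longrightarrow> uenv C f k c1 \<le> f c1 + eps / 2"
    using uenv_approx[OF IntD1[OF c1(1)] half_gt_zero[OF eps(1)]] by blast
  obtain n2 where n2: "\<And>k. real n2 \<le> k \<Longrightarrow> f c2 - eps / 2 \<le> lenv C f k c2"
    using lenv_approx[OF IntD1[OF c2(1)] half_gt_zero[OF eps(1)]] by blast
  \<comment> \<open>With \<open>8 * M\<close> in place of \<open>3 * M\<close>, the bound survives
    the passage to \<open>rho x \<ge> 3 / 4 * rho p\<close> and still leaves at least
    \<open>2 * M\<close> at radius \<open>3 / 8 * rho p\<close>.\<close>
  obtain n3 :: nat where n3: "8 * M / rho p \<le> real n3" using real_arch_simple by blast
  define n where "n = n1 + n2 + n3 + j"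
  have "8 * M / rho p \<le> real n" using n3 by (simp add: n_def)
  then have nrho: "8 * M \<le> real n * rho p" using rp by (simp add: pos_divide_le_eq)
  have "good x n" if x: "x \<in> X" "dist p x < ?r" for x
    unfolding good_def
  proof (intro conjI allI impI)
    have rx: "rho p * 3 / 4 \<le> rho x" using rho_triangle[of p x] x(2) rp by simp
    have "real n * (rho p * 3 / 4) \<le> real n * rho x" using rx by (intro mult_left_mono) auto
    moreover have "real n * (rho p * 3 / 4) = real n * rho p * 3 / 4" by simp
    ultimately show "3 * M \<le> real n * rho x" using nrho M by linarith
    show "j \<le> n" by (simp add: n_def)
    fix v t
    assume v: "continuous_on X v" and t: "lenv C f n x \<le> t" "t \<le> uenv C f n x"
      and sq: "\<forall>y\<in>ball x (rho x). lenv C f n y \<le> v y \<and> v y \<le> uenv C f n y"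
    \<comment> \<open>\<open>3 / 8 + 1 / 8 = 1 / 2\<close>: what is this near to \<open>x\<close>
      lies in the ball around \<open>p\<close>.\<close>
    have in_B: "c \<in> ?B" if "dist x c < rho p * 3 / 8" for c
      using dist_triangle[of p c x] that x(2) by simp
    have r38: "2 * M \<le> real n * (rho p * 3 / 8)" using nrho M by simp
    have "f c1 - eps / 2 \<le> lenv C f n x"
    proof (rule lenv_ge_local[OF _ r38])
      show "f c1 - eps / 2 \<le> M" using bound[OF IntD1[OF c1(1)]] eps by linarith
      show "f c1 - eps / 2 \<le> f c" if "c \<in> C" "dist x c < rho p * 3 / 8" for c
        using c1(2)[of c] in_B that by auto
    qed simp
    moreover have "- (f c2 + eps / 2) \<le> lenv C (\<lambda>c. - f c) n x"
    proof (rule neg.lenv_ge_local[OF _ r38])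
      show "- (f c2 + eps / 2) \<le> M" using bound[OF IntD1[OF c2(1)]] eps by linarith
      show "- (f c2 + eps / 2) \<le> - f c" if "c \<in> C" "dist x c < rho p * 3 / 8" for c
        using c2(2)[of c] in_B that by auto
    qed simp
    ultimately have t': "f c1 - eps / 2 \<le> t" "t \<le> f c2 + eps / 2"
      using t by (simp_all add: uenv_def)
    \<comment> \<open>\<open>1 / 8 + 1 / 2 < 3 / 4\<close>, so the squeezing around \<open>x\<close>
      applies on the whole ball around \<open>p\<close>.\<close>
    have ball_sub: "?B \<subseteq> ball x (rho x)"
    proof
      fix y assume "y \<in> ?B"
      then show "y \<in> ball x (rho x)" using dist_triangle[of x y p] x(2) rx rp by (simp add: dist_commute)
    qed
    have v1: "v c1 \<le> f c1 + eps / 2" using sq ball_sub c1(1) n1[of n] by (fastforce simp: n_def)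
    have v2: "f c2 - eps / 2 \<le> v c2" using sq ball_sub c2(1) n2[of n] by (fastforce simp: n_def)
    have "\<exists>x'\<in>?B. \<bar>t - v x'\<bar> \<le> eps"
    proof (cases "v c1 \<le> t \<and> t \<le> v c2")
      case True
      have "connected (v ` ?B)"
        using continuous_on_subset[OF v BX] by (intro connected_continuous_image) auto
      then have "t \<in> v ` ?B" using True c1(1) c2(1) connectedD_interval by blast
      then show ?thesis using eps by force
    next
      case False
      \<comment> \<open>If \<open>t\<close> is outside the range, it and the nearer end value are
        separated by at most two errors of \<open>eps / 2\<close>.\<close>
      then have "\<bar>t - v c1\<bar> \<le> eps \<or> \<bar>t - v c2\<bar> \<le> eps" using v1 v2 t' by linarith
      then show ?thesis using c1(1) c2(1) by blast
    qed
    then obtain x' where x': "x' \<in> ?B" "\<bar>t - v x'\<bar> \<le> eps" by auto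
    have "dist x x' \<le> eps" using x'(1) dist_triangle[of x x' p] x(2) rho_le(1)[of p] eps
      by (simp add: dist_commute)
    then show "\<exists>x'\<in>X. dist x x' \<le> eps \<and> \<bar>t - v x'\<bar> \<le> eps" using x' BX by blast
  qed
  then show ?thesis using rp by (intro exI[of _ ?r]) auto
qed

text \<open>The value \<open>f x\<close> is recovered at a nearby \<open>c\<close> rather than at
  \<open>x\<close>, because the convergence of the envelopes to \<open>f\<close> at continuity
  points is in general not locally uniform.\<close>

definition adequate :: "('a \<Rightarrow> real) \<Rightarrow> 'a \<Rightarrow> nat \<Rightarrow> bool" where
  "adequate V x n \<longleftrightarrow> V x \<le> real n \<and>
    (x \<in> C \<longrightarrow> (\<exists>c\<in>X. dist x c \<le> eps / V x \<and> f x - eps \<le> lenv C f n c))"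

lemma adequate_mono:
  assumes "adequate V x m" "m \<le> n"
  shows "adequate V x n"
proof -
  have "lenv C f m c \<le> lenv C f n c" for c using lenv_mono[of m n c] assms(2) by simp
  then show ?thesis using assms unfolding adequate_def by (meson of_nat_mono order_trans)
qed

text \<open>One point \<open>c\<close> where \<open>f\<close> is nearly maximal on a small ball
  serves all \<open>x\<close> of that ball. Its radius is at most half of
  \<open>a = eps / (V p + 1)\<close>, since \<open>x\<close> and \<open>c\<close> may be two radii
  apart and \<open>V x \<le> V p + 1\<close> there.\<close>

lemma adequate_locally:
  assumes V: "continuous_on X V" "\<And>x. x \<in> X \<Longrightarrow> 0 < V x" and p: "p \<in> X"
  shows "\<exists>r>0. \<exists>n. \<forall>x\<in>X. dist p x < r \<longrightarrow> adequate V x n"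
proof -
  obtain r1 where r1: "0 < r1" "\<And>x. x \<in> X \<Longrightarrow> dist x p < r1 \<Longrightarrow> dist (V x) (V p) < 1"
    using V(1) p unfolding continuous_on_iff by (metis zero_less_one)
  have Vp: "0 < V p" using V(2)[OF p] .
  define a where "a = eps / (V p + 1)"
  have a: "0 < a" using eps Vp by (simp add: a_def)
  define r where "r = min r1 (a / 2)"
  have r3: "2 * r \<le> a" by (simp add: r_def)
  have r: "0 < r" "r \<le> r1" using r1(1) a by (auto simp: r_def)
  obtain c0 where "c0 \<in> C" "dist p c0 < r" using near[OF p r(1)] .
  then have ne: "C \<inter> ball p r \<noteq> {}" by auto
  obtain c where c: "c \<in> C \<inter> ball p r" "\<And>c'. c' \<in> C \<inter> ball p r \<Longrightarrow> f c' \<le> f c + eps / 2"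
    using near_supremum[OF Int_lower1 ne half_gt_zero[OF eps(1)]] by blast
  obtain n1 where n1: "\<And>k. real n1 \<le> k \<Longrightarrow> f c - eps / 2 \<le> lenv C f k c"
    using lenv_approx[OF IntD1[OF c(1)] half_gt_zero[OF eps(1)]] by blast
  obtain n2 :: nat where n2: "V p + 1 \<le> real n2" using real_arch_simple by blast
  have "adequate V x (n1 + n2)" if x: "x \<in> X" "dist p x < r" for x
  proof -
    have Vx: "V x \<le> V p + 1" using r1(2)[OF x(1)] x(2) r(2) by (simp add: dist_commute dist_real_def)
    have "a \<le> eps / V x" unfolding a_def using Vx V(2)[OF x(1)] eps Vp by (intro divide_left_mono) auto
    moreover have "dist x c \<le> 2 * r"
      using dist_triangle[of x c p] x(2) c(1) by (simp add: dist_commute)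
    ultimately have "dist x c \<le> eps / V x" using r3 by linarith
    moreover have "f x - eps \<le> lenv C f (n1 + n2) c" if "x \<in> C"
      using c(2)[of x] n1[of "real (n1 + n2)"] that x(2) by simp
    ultimately show ?thesis unfolding adequate_def using Vx n2 c(1) C_sub_X by auto
  qed
  then show ?thesis using r(1) by blast
qed

end

text \<open>\<open>V\<close> dominates the thresholds \<open>L\<close> and fixes the scale \<open>eps / V\<close> at which \<open>w\<close> has to recover
  the values of \<open>f\<close>: for slopes below \<open>V\<close> moving a point by \<open>eps / V\<close> costs at most \<open>eps\<close>.\<close>

locale approximant = approximation X C f M eps j
  for X C :: "'a::euclidean_space set" and f M eps j +
  fixes L :: "'a \<Rightarrow> nat" and V w :: "'a \<Rightarrow> real"
  assumes good: "\<And>x. x \<in> X \<Longrightarrow> good x (L x)"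
    and V_ge: "\<And>x y. x \<in> X \<Longrightarrow> y \<in> X \<Longrightarrow> dist x y \<le> bdist y / 2 \<Longrightarrow> real (L x) \<le> V y"
    and V_pos: "\<And>y. y \<in> X \<Longrightarrow> 0 < V y"
    and w_cont: "continuous_on X w" and w_pos: "\<And>y. y \<in> X \<Longrightarrow> 0 < w y"
    and w_ge: "\<And>y. y \<in> X \<Longrightarrow> V y \<le> w y"
    and w_approx: "\<And>x. x \<in> C \<Longrightarrow> \<exists>c\<in>X. dist x c \<le> eps / V x \<and>
      (dist x c \<le> bdist c / 2 \<longrightarrow> f x - eps \<le> lenv C f (w c) c)"
begin

definition g :: "'a \<Rightarrow> real" where
  "g y = lenv C f (w y) y"

lemma L_rho: "x \<in> X \<Longrightarrow> 3 * M \<le> real (L x) * rho x"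
  and j_le_L: "x \<in> X \<Longrightarrow> j \<le> L x"
  using good by (auto simp: good_def)

lemma w_ge_L: "x \<in> X \<Longrightarrow> y \<in> X \<Longrightarrow> dist x y \<le> bdist y / 2 \<Longrightarrow> real (L x) \<le> w y"
  using V_ge w_ge order_trans by blast

lemma V_ge_L: "x \<in> X \<Longrightarrow> real (L x) \<le> V x"
  using V_ge[of x x] bdist_pos[of x] by simp

text \<open>From \<open>eps \<le> 3 * M \<le> V c * rho c\<close> the recovery distance
  \<open>eps / V c\<close> is at most \<open>rho c\<close>, so the premise on \<open>bdist\<close>
  in \<open>w_approx\<close> is met.\<close>

lemma g_approx:
  assumes c: "c \<in> C"
  obtains c' where "c' \<in> X" "dist c c' \<le> eps / V c" "f c - eps \<le> g c'"
proof -
  have cX: "c \<in> X" using c C_sub_X by auto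
  obtain c' where c': "c' \<in> X" "dist c c' \<le> eps / V c"
    "dist c c' \<le> bdist c' / 2 \<longrightarrow> f c - eps \<le> lenv C f (w c') c'"
    using w_approx[OF c] by auto
  have "real (L c) * rho c \<le> V c * rho c"
    using V_ge_L[OF cX] rho_pos[OF cX] by (intro mult_right_mono) auto
  then have "eps \<le> V c * rho c" using L_rho[OF cX] M eps by linarith
  then have "eps / V c \<le> rho c" using V_pos[OF cX] by (simp add: pos_divide_le_eq mult.commute)
  then have "dist c c' \<le> bdist c' / 2"
    using c'(2) rho_le(2)[of c] bdist_le[of c c'] bdist_pos[OF c'(1)] by linarith
  then show ?thesis using that[of c'] c' by (simp add: g_def)
qed

lemma abs_g_le: "y \<in> X \<Longrightarrow> \<bar>g y\<bar> \<le> M"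
  unfolding g_def using w_pos[of y] by (intro abs_lenv_le) auto

lemma g_le_f: "c \<in> C \<Longrightarrow> g c \<le> f c"
  unfolding g_def using w_pos[of c] C_sub_X by (intro lenv_le_fun) (auto intro: less_imp_le)

lemma continuous_g: "continuous_on X g"
  unfolding continuous_on_def
proof
  fix x assume x: "x \<in> X"
  obtain D where D: "\<And>y z. y \<in> X \<Longrightarrow> z \<in> X \<Longrightarrow> dist y z \<le> D"
    using bdd unfolding bounded_two_points by blast
  have D0: "0 \<le> D" using D[OF x x] by simp
  have "((\<lambda>y. g y - g x) \<longlongrightarrow> 0) (at x within X)"
  proof (rule Lim_null_comparison)
    show "\<forall>\<^sub>F y in at x within X. norm (g y - g x) \<le> \<bar>w y - w x\<bar> * D + w x * dist y x"
      unfolding eventually_at_filter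
    proof (intro always_eventually allI impI)
      fix y assume y: "y \<in> X"
      have "\<bar>lenv C f (w y) y - lenv C f (w x) y\<bar> \<le> \<bar>w y - w x\<bar> * D"
        using w_pos x y D D0 C_sub_X by (intro lenv_diff_slope) (auto intro: less_imp_le)
      moreover have "\<bar>lenv C f (w x) y - lenv C f (w x) x\<bar> \<le> w x * dist y x"
        using lipschitz_onD[OF lipschitz_lenv[of "w x" X] y x] w_pos[OF x] by (simp add: dist_real_def)
      ultimately show "norm (g y - g x) \<le> \<bar>w y - w x\<bar> * D + w x * dist y x"
        unfolding g_def real_norm_def by linarith
    qed
    have "(w \<longlongrightarrow> w x) (at x within X)" using w_cont x by (simp add: continuous_on_def)
    then have "((\<lambda>y. \<bar>w y - w x\<bar> * D + w x * dist y x) \<longlongrightarrow> \<bar>w x - w x\<bar> * D + w x * dist x x) (at x within X)"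
      by (intro tendsto_intros)
    then show "((\<lambda>y. \<bar>w y - w x\<bar> * D + w x * dist y x) \<longlongrightarrow> 0) (at x within X)" by simp
  qed
  then show "(g \<longlongrightarrow> g x) (at x within X)" by (rule LIM_zero_cancel)
qed

sublocale g: dense_fun X g M X
  by unfold_locales (use X_nonempty abs_g_le closure_subset in auto)

sublocale neg_g: dense_fun X "\<lambda>c. - g c" M X
  by (rule g.uminus)

section \<open>Comparing the envelopes of \<open>g\<close> and \<open>f\<close>\<close>

lemma lenv_g_le:
  assumes "0 \<le> k"
  shows "lenv X g k x \<le> lenv C f k x"
proof (rule lenv_ge)
  show "lenv X g k x \<le> f c + k * dist x c" if "c \<in> C" for c
    using g.lenv_le[OF assms C_sub_X[OF that], of x] g_le_f[OF that] by linarith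
qed

text \<open>\<open>g_le_f\<close> speaks about \<open>C\<close> only, whereas
  \<open>uenv X g\<close> depends on \<open>g\<close> on all of \<open>X\<close>. What holds
  everywhere is \<open>g y \<le> uenv C f k y\<close>, because \<open>g y\<close> is itself a value
  of a lower envelope of \<open>f\<close>.\<close>

lemma uenv_g_le:
  assumes "0 \<le> k"
  shows "uenv X g k x \<le> uenv C f k x"
proof -
  have "lenv C (\<lambda>c. - f c) k x \<le> lenv X (\<lambda>c. - g c) k x"
  proof (rule neg_g.lenv_ge)
    fix y assume y: "y \<in> X"
    have "g y \<le> uenv C f k y"
      unfolding g_def using w_pos[OF y] assms y by (intro lenv_le_uenv) auto
    then show "lenv C (\<lambda>c. - f c) k x \<le> - g y + k * dist x y"
      using neg.lenv_diff_le[OF assms, of x y] by (simp add: uenv_def)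
  qed
  then show ?thesis by (simp add: uenv_def)
qed

text \<open>A point \<open>y\<close> where \<open>w\<close> is too small for the slope \<open>k \<le> L x\<close> is so far from \<open>x\<close> that it does
  not influence the envelope at \<open>x\<close>.\<close>

lemma lenv_g_eq:
  assumes x: "x \<in> X" and k: "0 \<le> k" "k \<le> real (L x)"
  shows "lenv X g k x = lenv C f k x"
proof (rule antisym[OF lenv_g_le[OF k(1)] g.lenv_ge])
  fix y assume y: "y \<in> X"
  show "lenv C f k x \<le> g y + k * dist x y"
  proof (cases "k \<le> w y")
    case True
    then show ?thesis
      using lenv_mono[OF k(1) True, of y] lenv_diff_le[OF k(1), of x y] by (simp add: g_def)
  next
    case False
    have "\<not> dist x y \<le> bdist y / 2" using w_ge_L[OF x y] False k(2) by linarith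
    \<comment> \<open>Now the threshold of \<open>y\<close> rather than that of \<open>x\<close>
      makes the distance costly: \<open>L y \<le> w y < k\<close>.\<close>
    then have "rho y \<le> dist x y" using rho_le(2)[of y] bdist_pos[OF y] by linarith
    moreover have "real (L y) \<le> k" using V_ge_L[OF y] w_ge[OF y] False by linarith
    ultimately have "real (L y) * rho y \<le> k * dist x y"
      using rho_pos[OF y] by (intro mult_mono) auto
    then show ?thesis
      using L_rho[OF y] abs_g_le[OF y] lenv_le_bound[OF k(1) x] M by (simp add: abs_le_iff)
  qed
qed

text \<open>A near-optimal \<open>c\<close> for \<open>f\<close> is replaced by a point
  \<open>c'\<close> where \<open>g\<close> recovers \<open>f c\<close>. The three errors
  \<open>eps\<close> come from choosing \<open>c\<close>, from the recovered value, and from moving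
  to \<open>c'\<close>. The last one requires \<open>k \<le> V c\<close>: either the threshold of
  \<open>c\<close> is at least \<open>k\<close>, or \<open>c\<close> is so near to \<open>x\<close>
  that \<open>V c\<close> dominates \<open>L x\<close>.\<close>

lemma uenv_g_ge:
  assumes x: "x \<in> X" and k: "0 \<le> k" "k \<le> real (L x)"
  shows "uenv C f k x - 3 * eps \<le> uenv X g k x"
proof -
  have "lenv C (\<lambda>c. - f c) k x < lenv C (\<lambda>c. - f c) k x + eps" using eps by simp
  then obtain c where c: "c \<in> C" "- f c + k * dist x c < lenv C (\<lambda>c. - f c) k x + eps"
    using neg.lenv_lessD by blast
  have cX: "c \<in> X" using c(1) C_sub_X by auto
  \<comment> \<open>The oscillation \<open>2 * M\<close> plus \<open>eps \<le> M\<close>; this is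
    the origin of the constant \<open>3 * M\<close> in \<open>good\<close>.\<close>
  have kd: "k * dist x c < 3 * M"
    using c(2) bound[OF c(1)] neg.lenv_le_bound[OF k(1) x] M eps by (simp add: abs_le_iff)
  have "k \<le> V c"
  proof (cases "k \<le> real (L c)")
    case True
    then show ?thesis using V_ge_L[OF cX] by linarith
  next
    case False
    have "dist x c < rho c"
    proof (rule ccontr)
      assume "\<not> dist x c < rho c"
      then have "real (L c) * rho c \<le> k * dist x c"
        using False rho_pos[OF cX] k by (intro mult_mono) auto
      then show False using kd L_rho[OF cX] by linarith
    qed
    then have "dist x c \<le> bdist c / 2" using rho_le(2)[of c] bdist_pos[OF cX] by linarith
    then show ?thesis using V_ge[OF x cX] k(2) by linarith
  qed
  obtain c' where c': "c' \<in> X" "dist c c' \<le> eps / V c" "f c - eps \<le> g c'"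
    using g_approx[OF c(1)] .
  have "k * dist c c' \<le> V c * (eps / V c)"
    using \<open>k \<le> V c\<close> c'(2) k(1) V_pos[OF cX] by (intro mult_mono) auto
  then have "k * dist c c' \<le> eps" using V_pos[OF cX] by simp
  moreover have "k * dist x c' \<le> k * dist x c + k * dist c c'"
    using mult_left_mono[OF dist_triangle[of x c' c] k(1)] by (simp add: distrib_left dist_commute)
  moreover have "lenv X (\<lambda>c. - g c) k x \<le> - g c' + k * dist x c'"
    by (rule neg_g.lenv_le[OF k(1) c'(1)])
  ultimately show ?thesis using c(2) c'(3) by (simp add: uenv_def)
qed

lemma lenv_le_g_near:
  assumes x: "x \<in> X" and y: "dist x y < rho x"
  shows "lenv C f (L x) y \<le> g y"
proof -
  have yX: "y \<in> X" using in_X_of_dist[of x y] y rho_le(2)[of x] bdist_pos[OF x] by linarith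
  have "dist x y \<le> bdist y / 2" using y rho_le(2)[of x] bdist_le[of x y] zero_le_dist[of x y] by linarith
  then show ?thesis unfolding g_def using w_ge_L[OF x yX] by (intro lenv_mono) auto
qed

text \<open>Competitors \<open>z\<close> with \<open>w z \<ge> L x\<close> compare directly. The
  others satisfy \<open>dist x z > bdist x / 3\<close>; as \<open>1 / 3 - 1 / 8 > 1 / 8\<close>,
  they are at least \<open>rho x\<close> away from \<open>y\<close> and cost
  \<open>3 * M\<close>.\<close>

lemma lenv_g_ge_near:
  assumes x: "x \<in> X" and k: "real (L x) \<le> k" and y: "dist x y < rho x"
  shows "lenv C f (L x) y \<le> lenv X g k y"
proof (rule g.lenv_ge)
  fix z assume z: "z \<in> X"
  have yX: "y \<in> X" using in_X_of_dist[of x y] y rho_le(2)[of x] bdist_pos[OF x] by linarith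
  show "lenv C f (L x) y \<le> g z + k * dist y z"
  proof (cases "real (L x) \<le> w z")
    case True
    have "lenv C f (L x) y \<le> lenv C f (L x) z + L x * dist y z" by (rule lenv_diff_le) simp
    also have "\<dots> \<le> g z + k * dist y z"
      unfolding g_def using True k by (intro add_mono lenv_mono mult_right_mono) auto
    finally show ?thesis .
  next
    case False
    then have "bdist z / 2 < dist x z" using w_ge_L[OF x z] by linarith
    then have "rho x \<le> dist y z"
      using dist_triangle[of x z y] y rho_le(2)[of x] bdist_le[of x z] bdist_pos[OF x] by linarith
    then have "real (L x) * rho x \<le> k * dist y z"
      using k rho_pos[OF x] by (intro mult_mono) auto
    then show ?thesis
      using L_rho[OF x] abs_g_le[OF z] lenv_le_bound[of "L x" y] yX M by (simp add: abs_le_iff)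
  qed
qed

lemma g_le_uenv_g: "0 \<le> k \<Longrightarrow> y \<in> X \<Longrightarrow> g y \<le> uenv X g k y"
  using neg_g.lenv_le_fun[of k y] by (simp add: uenv_def)

text \<open>Supplies the premise of \<open>good\<close>: above the threshold, all four envelopes can
  play the role of \<open>v\<close>.\<close>

lemma squeezed:
  assumes x: "x \<in> X" and k: "real (L x) \<le> k" and y: "dist x y < rho x"
    and v: "v = lenv C f k \<or> v = lenv X g k \<or> v = uenv C f k \<or> v = uenv X g k"
  shows "lenv C f (L x) y \<le> v y \<and> v y \<le> uenv C f (L x) y"
proof -
  have k0: "0 \<le> k" using k by linarith
  have yX: "y \<in> X" using in_X_of_dist[of x y] y rho_le(2)[of x] bdist_pos[OF x] by linarith
  have "lenv C f k y \<le> uenv C f (L x) y" "lenv C f (L x) y \<le> uenv C f k y"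
    using lenv_le_uenv[OF _ _ yX] k0 by auto
  moreover have "lenv C f (L x) y \<le> lenv C f k y" "uenv C f k y \<le> uenv C f (L x) y"
    using lenv_mono uenv_antimono k by auto
  moreover have "lenv X g k y \<le> lenv C f k y" "uenv X g k y \<le> uenv C f k y"
    using lenv_g_le uenv_g_le k0 by auto
  moreover have "lenv C f (L x) y \<le> lenv X g k y" using lenv_g_ge_near[OF x k y] .
  moreover have "lenv C f (L x) y \<le> uenv X g k y"
    using lenv_le_g_near[OF x y] g_le_uenv_g[OF k0 yX] by linarith
  ultimately show ?thesis using v by auto
qed

text \<open>Up to \<open>L x\<close> the two values nearly agree at \<open>x\<close>, which gives
  both claims with \<open>y = x\<close>. Beyond it \<open>good\<close> provides \<open>y\<close>,
  and \<open>j \<le> L x\<close> bounds the difference at \<open>x\<close> by the gap at slope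
  \<open>j\<close>. The pairs are ordered because graph distance needs both directions.\<close>

lemma close_pair:
  assumes x: "x \<in> X" and k: "0 \<le> k"
    and uv: "(u, v) \<in> {(lenv C f k, lenv X g k), (lenv X g k, lenv C f k),
      (uenv C f k, uenv X g k), (uenv X g k, uenv C f k)}"
  shows "\<exists>y\<in>X. dist x y \<le> eps \<and> \<bar>u x - v y\<bar> \<le> 3 * eps"
    and "\<bar>u x - v x\<bar> \<le> 3 * eps + (uenv C f j x - lenv C f j x)"
proof -
  have j0: "lenv C f j x \<le> uenv C f j x" using lenv_le_uenv x by simp
  have "(\<exists>y\<in>X. dist x y \<le> eps \<and> \<bar>u x - v y\<bar> \<le> 3 * eps) \<and>
    \<bar>u x - v x\<bar> \<le> 3 * eps + (uenv C f j x - lenv C f j x)"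
  proof (cases "k \<le> real (L x)")
    case True
    have "\<bar>u x - v x\<bar> \<le> 3 * eps"
      using uv lenv_g_eq[OF x k True] uenv_g_ge[OF x k True] uenv_g_le[OF k, of x] eps by auto
    then show ?thesis using x eps j0 by (intro conjI bexI[of _ x]) auto
  next
    case False
    then have k': "real (L x) \<le> k" by simp
    have cont_v: "continuous_on X v"
      using uv continuous_lenv[OF k] continuous_uenv[OF k] g.continuous_lenv[OF k] g.continuous_uenv[OF k]
      by auto
    have sq: "lenv C f (L x) y \<le> u y \<and> u y \<le> uenv C f (L x) y"
      "lenv C f (L x) y \<le> v y \<and> v y \<le> uenv C f (L x) y" if "dist x y < rho x" for y
      by (rule squeezed[OF x k' that]; use uv in blast)+
    have sqx: "lenv C f (L x) x \<le> u x" "u x \<le> uenv C f (L x) x"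
      "lenv C f (L x) x \<le> v x" "v x \<le> uenv C f (L x) x"
      using sq[of x] rho_pos[OF x] by auto
    have "\<exists>y\<in>X. dist x y \<le> eps \<and> \<bar>u x - v y\<bar> \<le> eps"
      using good[OF x] cont_v sqx sq(2) unfolding good_def by auto
    then have "\<exists>y\<in>X. dist x y \<le> eps \<and> \<bar>u x - v y\<bar> \<le> 3 * eps" using eps by force
    moreover have "lenv C f j x \<le> lenv C f (L x) x" "uenv C f (L x) x \<le> uenv C f j x"
      using lenv_mono[of j "L x" x] uenv_antimono[of j "L x" x] j_le_L[OF x] by auto
    ultimately show ?thesis using sqx eps by (auto simp: abs_le_iff)
  qed
  then show "\<exists>y\<in>X. dist x y \<le> eps \<and> \<bar>u x - v y\<bar> \<le> 3 * eps"
    "\<bar>u x - v x\<bar> \<le> 3 * eps + (uenv C f j x - lenv C f j x)" by auto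
qed

end

text \<open>Domination is applied twice, as the second requirement \<open>adequate V\<close> can
  only be stated once \<open>V\<close> is fixed.\<close>

lemma (in approximation) continuous_approximant:
  obtains g where "continuous_on X g" "\<And>x. x \<in> X \<Longrightarrow> \<bar>g x\<bar> \<le> M"
    "\<And>k x u v. 0 \<le> k \<Longrightarrow> x \<in> X \<Longrightarrow> (u, v) \<in> {(lenv C f k, lenv X g k), (lenv X g k, lenv C f k),
        (uenv C f k, uenv X g k), (uenv X g k, uenv C f k)} \<Longrightarrow>
      (\<exists>y\<in>X. dist x y \<le> eps \<and> \<bar>u x - v y\<bar> \<le> 3 * eps) \<and>
      \<bar>u x - v x\<bar> \<le> 3 * eps + (uenv C f j x - lenv C f j x)"
proof -
  \<comment> \<open>\<open>good_mono\<close> assumes \<open>x \<in> X\<close>, while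
    \<open>continuous_domination\<close> asks for monotonicity at every \<open>x\<close>; hence the
    guard.\<close>
  define R where "R x n \<longleftrightarrow> x \<in> X \<longrightarrow> good x n" for x n
  obtain L :: "'a \<Rightarrow> nat" and V where LV: "\<And>x. x \<in> X \<Longrightarrow> R x (L x)" "continuous_on X V"
    "\<And>y. y \<in> X \<Longrightarrow> 0 < V y"
    "\<And>x y. x \<in> X \<Longrightarrow> y \<in> X \<Longrightarrow> dist x y \<le> bdist y / 2 \<Longrightarrow> real (L x) \<le> V y"
  proof (rule continuous_domination[of R])
    show "R x n" if "R x m" "m \<le> n" for x m n using that good_mono by (auto simp: R_def)
    show "\<exists>r>0. \<exists>n. \<forall>x\<in>X. dist p x < r \<longrightarrow> R x n" if "p \<in> X" for p
      using good_locally[OF that] by (auto simp: R_def)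
  qed blast
  obtain L' :: "'a \<Rightarrow> nat" and w where Lw: "\<And>x. x \<in> X \<Longrightarrow> adequate V x (L' x)" "continuous_on X w"
    "\<And>y. y \<in> X \<Longrightarrow> 0 < w y"
    "\<And>x y. x \<in> X \<Longrightarrow> y \<in> X \<Longrightarrow> dist x y \<le> bdist y / 2 \<Longrightarrow> real (L' x) \<le> w y"
  proof (rule continuous_domination[of "adequate V"])
    show "adequate V x n" if "adequate V x m" "m \<le> n" for x m n using that by (rule adequate_mono)
    show "\<exists>r>0. \<exists>n. \<forall>x\<in>X. dist p x < r \<longrightarrow> adequate V x n" if "p \<in> X" for p
      using adequate_locally[OF LV(2,3) that] .
  qed blast
  interpret approximant X C f M eps j L V w
  proof
    show "good x (L x)" if "x \<in> X" for x using LV(1)[OF that] that by (simp add: R_def)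
    show "V y \<le> w y" if "y \<in> X" for y
      using Lw(1)[OF that] Lw(4)[OF that that] bdist_pos[OF that] by (simp add: adequate_def)
    show "\<exists>c\<in>X. dist x c \<le> eps / V x \<and> (dist x c \<le> bdist c / 2 \<longrightarrow> f x - eps \<le> lenv C f (w c) c)"
      if x: "x \<in> C" for x
    proof -
      have xX: "x \<in> X" using x C_sub_X by auto
      obtain c where c: "c \<in> X" "dist x c \<le> eps / V x" "f x - eps \<le> lenv C f (L' x) c"
        using Lw(1)[OF xX] x by (auto simp: adequate_def)
      have "f x - eps \<le> lenv C f (w c) c" if "dist x c \<le> bdist c / 2"
        using c(3) lenv_mono[OF _ Lw(4)[OF xX c(1) that], of c] by simp
      then show ?thesis using c by blast
    qed
  qed (use LV Lw in auto)
  show ?thesis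
    by (rule that[OF continuous_g abs_g_le], assumption) (rule conjI[OF close_pair])
qed

section \<open>From the approximant to density\<close>

context domain
begin

lemma continuous_in_Cae:
  assumes "continuous_on X g" "bounded (g ` X)"
  shows "g \<in> Cae X" "cpts X g = X"
  using assms by (auto simp: Cae_def cpts_def continuous_on_eq_continuous_within)

text \<open>The graphs contribute \<open>e + 3 * e\<close>, the integral contributes
  \<open>3 * e\<close> times the measure plus the integral of \<open>h\<close>.\<close>

lemma delta_le_of_close:
  assumes L: "L-lipschitz_on X \<phi>" "L'-lipschitz_on X \<psi>"
    and close: "\<And>x. x \<in> X \<Longrightarrow> \<exists>y\<in>X. dist x y \<le> e \<and> \<bar>\<phi> x - \<psi> y\<bar> \<le> 3 * e"
      "\<And>x. x \<in> X \<Longrightarrow> \<exists>y\<in>X. dist x y \<le> e \<and> \<bar>\<psi> x - \<phi> y\<bar> \<le> 3 * e"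
    and le: "\<And>x. x \<in> X \<Longrightarrow> \<bar>\<phi> x - \<psi> x\<bar> \<le> 3 * e + h x"
    and h: "h integrable_on X"
  shows "delta X \<phi> \<psi> \<le> (4 + 3 * measure lebesgue X) * e + integral X h"
proof -
  have m: "X \<in> lmeasurable" using op bdd lmeasurable_open by blast
  have c: "(\<lambda>x. 3 * e) integrable_on X" by (rule integrable_on_const[OF m])
  have "integral X (\<lambda>x. \<bar>\<phi> x - \<psi> x\<bar>) \<le> integral X (\<lambda>x. 3 * e + h x)"
    by (rule integral_le[OF integrable_abs_diff[OF op bdd L] integrable_add[OF c h] le])
  also have "\<dots> = integral X (\<lambda>x. 3 * e) + integral X h"
    by (rule Henstock_Kurzweil_Integration.integral_add[OF c h])
  also have "integral X (\<lambda>x. 3 * e) = measure lebesgue X * (3 * e)"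
    using lmeasure_integral[OF m] integral_mult_left[of X "\<lambda>_. 1" "3 * e"] by simp
  finally show ?thesis
    using hgraph_leI[OF X_nonempty close] unfolding delta_def by (simp add: algebra_simps)
qed

lemma continuous_dense:
  assumes f: "f \<in> Cae X" and e: "0 < e"
  shows "\<exists>g. continuous_on X g \<and> bounded (g ` X) \<and> r_metric X f g < ereal e"
proof -
  obtain M where M: "1 \<le> M" "\<And>x. x \<in> X \<Longrightarrow> \<bar>f x\<bar> \<le> M" using Cae_bound[OF f] by metis
  let ?C = "cpts X f"
  interpret dense_fun ?C f M X using dense_fun_Cae op X_nonempty f M by blast
  define m where "m = measure lebesgue X"
  have m: "0 \<le> m" by (simp add: m_def)
  \<comment> \<open>The total error is at most \<open>(4 + 3 * m) * eps\<close> plus the integral of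
    the gap at slope \<open>j\<close>, itself below \<open>eps\<close>. Aiming at
    \<open>e / 2\<close> keeps the final inequality strict after the supremum over
    \<open>k\<close>.\<close>
  define eps where "eps = min 1 (e / (2 * (5 + 3 * m)))"
  have eps01: "0 < eps" "eps \<le> 1" and eps_e: "eps * (5 + 3 * m) \<le> e / 2"
  proof -
    have "eps \<le> e / (2 * (5 + 3 * m))" by (simp add: eps_def)
    then show "eps * (5 + 3 * m) \<le> e / 2" using m by (simp add: field_simps)
  qed (use e m in \<open>auto simp: eps_def\<close>)
  obtain j where j: "integral X (\<lambda>x. upper_env X j f x - lower_env X j f x) < eps"
    using order_tendstoD(2)[OF integral_upper_minus_lower_tendsto_0[OF f] eps01(1)]
    by (auto simp: eventually_sequentially)
  interpret approximation X ?C f M eps j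
    by unfold_locales (use M eps01 in \<open>auto simp: cpts_def\<close>)
  obtain g where g: "continuous_on X g" "\<And>x. x \<in> X \<Longrightarrow> \<bar>g x\<bar> \<le> M"
    and close: "\<And>k x u v. 0 \<le> k \<Longrightarrow> x \<in> X \<Longrightarrow> (u, v) \<in> {(lenv ?C f k, lenv X g k), (lenv X g k, lenv ?C f k),
        (uenv ?C f k, uenv X g k), (uenv X g k, uenv ?C f k)} \<Longrightarrow>
      (\<exists>y\<in>X. dist x y \<le> eps \<and> \<bar>u x - v y\<bar> \<le> 3 * eps) \<and>
      \<bar>u x - v x\<bar> \<le> 3 * eps + (uenv ?C f j x - lenv ?C f j x)"
    using continuous_approximant by metis
  have bg: "bounded (g ` X)" using g(2) by (auto simp: bounded_iff)
  note gC = continuous_in_Cae[OF g(1) bg]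
  let ?h = "\<lambda>x. upper_env X j f x - lower_env X j f x"
  have h: "?h integrable_on X"
    using integrable_abs_diff[OF op bdd lipschitz_upper[OF f] lipschitz_lower[OF f], of j j]
      lower_le_upper[OF f] by (simp cong: Henstock_Kurzweil_Integration.integrable_cong)
  have env: "lower_env X k f x = lenv ?C f k x" "upper_env X k f x = uenv ?C f k x"
    "lower_env X k g x = lenv X g k x" "upper_env X k g x = uenv X g k x" if "x \<in> X" for k x
    using lower_env_eq_lenv[OF op X_nonempty f that] upper_env_eq_uenv[OF op X_nonempty f that]
      lower_env_eq_lenv[OF op X_nonempty gC(1) that] upper_env_eq_uenv[OF op X_nonempty gC(1) that]
    by (simp_all add: gC(2))
  have "(4 + 3 * m) * eps + integral X ?h \<le> e / 2"
    using j eps_e by (simp add: algebra_simps)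
  moreover have "delta X (lower_env X k f) (lower_env X k g) \<le> (4 + 3 * m) * eps + integral X ?h"
    "delta X (upper_env X k f) (upper_env X k g) \<le> (4 + 3 * m) * eps + integral X ?h" for k
    unfolding m_def
    by (rule delta_le_of_close[OF lipschitz_lower[OF f] lipschitz_lower[OF gC(1)] _ _ _ h]
        delta_le_of_close[OF lipschitz_upper[OF f] lipschitz_upper[OF gC(1)] _ _ _ h];
        use close[of "real k"] env in \<open>simp cong: bex_cong\<close>)+
  ultimately have "r_metric X f g \<le> ereal (e / 2)"
    unfolding r_metric_le_iff by (meson order_trans)
  also have "\<dots> < ereal e" using e by simp
  finally show ?thesis using g(1) bg by blast
qed

end

theorem theorem2p2:
  fixes X :: "'a::euclidean_space set"
  assumes "X \<noteq> {}" and "open X" and "bounded X"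
  shows
    \<comment> \<open>r is well defined on equivalence classes\<close>
    "(\<forall>f\<in>Cae X. \<forall>f'\<in>Cae X. \<forall>g\<in>Cae X. ae_eq X f f' \<longrightarrow> r_metric X f g = r_metric X f' g)
     \<comment> \<open>r is a (finite) metric on C_ae(X,R)\<close>
     \<and> (\<forall>f\<in>Cae X. \<forall>g\<in>Cae X. r_metric X f g < \<infinity>)
     \<and> (\<forall>f\<in>Cae X. \<forall>g\<in>Cae X. r_metric X f g = 0 \<longleftrightarrow> ae_eq X f g)
     \<and> (\<forall>f\<in>Cae X. \<forall>g\<in>Cae X. r_metric X f g = r_metric X g f)
     \<and> (\<forall>f\<in>Cae X. \<forall>g\<in>Cae X. \<forall>h\<in>Cae X. r_metric X f h \<le> r_metric X f g + r_metric X g h)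
     \<comment> \<open>completeness\<close>
     \<and> (\<forall>F. (\<forall>n. F n \<in> Cae X) \<longrightarrow>
           (\<forall>e>0. \<exists>N. \<forall>m\<ge>N. \<forall>n\<ge>N. r_metric X (F m) (F n) < ereal e) \<longrightarrow>
           (\<exists>f\<in>Cae X. (\<lambda>n. r_metric X (F n) f) \<longlonglongrightarrow> 0))
     \<comment> \<open>density of bounded continuous functions\<close>
     \<and> (\<forall>f\<in>Cae X. \<forall>e>0. \<exists>g. continuous_on X g \<and> bounded (g ` X) \<and> r_metric X f g < ereal e)"
proof -
  interpret domain X by unfold_locales (fact assms)+
  show ?thesis
    by (intro conjI ballI allI impI)
      (use r_metric_cong r_metric_finite r_metric_eq_0_iff r_metric_commute r_metric_triangle
        r_metric_complete continuous_dense in blast)+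
qed

end
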